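(* (In $\mathsf{ZF}$.) Let $V$ be a $\mathbb{Q}$-vector space that has a basis. Then $V\not\to(2)^{\cdot+\cdot}_{\omega}$. That is, there exists a colouring $c:V\to\omega$ such that there is no set $X\subseteq V$ with exactly two elements for which $X+X$ is $c$-monochromatic.
   Context: The base theory is $\mathsf{ZF}$ (no form of the Axiom of Choice is assumed). The basis of $V$ is a Hamel basis over $\mathbb{Q}$, not assumed well-orderable. $X+X=\{a+b : a,b\in X\}$ (the case $a=b$ is included). A set is $c$-monochromatic if $c$ is constant on it. *)

theory Defs
  imports "HOL-Algebra.Module"
begin

text \<open>
  Isabelle/HOL contains a choice operator, so a statement about HOL sets cannot express that a
  theorem is provable without the Axiom of Choice.  A theorem of ZF is therefore rendered as a
  statement about arbitrary first-order models of ZF: a type \<open>'m\<close> with a binary relation satisfying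
  the axioms of ZF, separation and replacement being schemes over first-order formulas with
  parameters.  By Goedel's completeness theorem, truth in all these models is provability in ZF.

  All mathematical objects of the theorem (natural numbers, rationals, vector spaces, bases,
  colourings) are elements of the model, and every quantifier over them ranges over \<open>'m\<close>.
  HOL sets and functions occur only as views of such elements, and choice in HOL does not turn
  them into elements of the model.
\<close>

text \<open>First-order formulas of set theory, with de Bruijn indices.\<close>

datatype fm = FMem nat nat | FEq nat nat | FNeg fm | FAnd fm fm | FEx fm

primrec sat :: "('m \<Rightarrow> 'm \<Rightarrow> bool) \<Rightarrow> (nat \<Rightarrow> 'm) \<Rightarrow> fm \<Rightarrow> bool" where
  "sat mem e (FMem i j) \<longleftrightarrow> mem (e i) (e j)"
| "sat mem e (FEq i j) \<longleftrightarrow> e i = e j"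
| "sat mem e (FNeg p) \<longleftrightarrow> \<not> sat mem e p"
| "sat mem e (FAnd p q) \<longleftrightarrow> sat mem e p \<and> sat mem e q"
| "sat mem e (FEx p) \<longleftrightarrow> (\<exists>x. sat mem (case_nat x e) p)"

locale ZF_model =
  fixes mem :: "'m \<Rightarrow> 'm \<Rightarrow> bool"  (infix "\<^bold>\<in>" 50)
  assumes extensionality: "(\<And>x. x \<^bold>\<in> a \<longleftrightarrow> x \<^bold>\<in> b) \<Longrightarrow> a = b"
    and foundation: "\<exists>x. x \<^bold>\<in> a \<Longrightarrow> \<exists>x. x \<^bold>\<in> a \<and> \<not> (\<exists>y. y \<^bold>\<in> x \<and> y \<^bold>\<in> a)"
    and pairing: "\<exists>c. \<forall>x. x \<^bold>\<in> c \<longleftrightarrow> x = a \<or> x = b"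
    and union: "\<exists>u. \<forall>x. x \<^bold>\<in> u \<longleftrightarrow> (\<exists>y. y \<^bold>\<in> a \<and> x \<^bold>\<in> y)"
    and power_set: "\<exists>p. \<forall>x. x \<^bold>\<in> p \<longleftrightarrow> (\<forall>y. y \<^bold>\<in> x \<longrightarrow> y \<^bold>\<in> a)"
    and infinity: "\<exists>w. (\<exists>z. z \<^bold>\<in> w \<and> (\<forall>x. \<not> x \<^bold>\<in> z)) \<and>
                       (\<forall>x. x \<^bold>\<in> w \<longrightarrow> (\<exists>s. s \<^bold>\<in> w \<and> (\<forall>u. u \<^bold>\<in> s \<longleftrightarrow> u \<^bold>\<in> x \<or> u = x)))"
    and separation: "\<exists>b. \<forall>x. x \<^bold>\<in> b \<longleftrightarrow> x \<^bold>\<in> a \<and> sat mem (case_nat x e) p"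
    and replacement:
      "(\<And>x y y'. x \<^bold>\<in> a \<Longrightarrow> sat mem (case_nat x (case_nat y e)) p \<Longrightarrow>
          sat mem (case_nat x (case_nat y' e)) p \<Longrightarrow> y = y') \<Longrightarrow>
       \<exists>b. \<forall>y. y \<^bold>\<in> b \<longleftrightarrow> (\<exists>x. x \<^bold>\<in> a \<and> sat mem (case_nat x (case_nat y e)) p)"

context
  fixes mem :: "'m \<Rightarrow> 'm \<Rightarrow> bool"  (infix "\<^bold>\<in>" 50)
begin

text \<open>
  Set-theoretic notions interpreted in the structure.  The terms given by definite descriptions
  denote as intended in every model of ZF; \<open>app f x\<close> is meant for \<open>x\<close> in the domain of \<open>f\<close>.
\<close>

definition elems :: "'m \<Rightarrow> 'm set" where
  "elems a = {x. x \<^bold>\<in> a}"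

definition upair :: "'m \<Rightarrow> 'm \<Rightarrow> 'm" where
  "upair a b = (THE c. \<forall>x. x \<^bold>\<in> c \<longleftrightarrow> x = a \<or> x = b)"

definition pair :: "'m \<Rightarrow> 'm \<Rightarrow> 'm" where
  "pair a b = upair (upair a a) (upair a b)"

definition cross :: "'m \<Rightarrow> 'm \<Rightarrow> 'm" where
  "cross a b = (THE c. \<forall>u. u \<^bold>\<in> c \<longleftrightarrow> (\<exists>x y. x \<^bold>\<in> a \<and> y \<^bold>\<in> b \<and> u = pair x y))"

definition func :: "'m \<Rightarrow> 'm \<Rightarrow> 'm \<Rightarrow> bool" where
  "func f a b \<longleftrightarrow>
     (\<forall>u. u \<^bold>\<in> f \<longrightarrow> (\<exists>x y. x \<^bold>\<in> a \<and> y \<^bold>\<in> b \<and> u = pair x y)) \<and>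
     (\<forall>x. x \<^bold>\<in> a \<longrightarrow> (\<exists>!y. pair x y \<^bold>\<in> f))"

definition app :: "'m \<Rightarrow> 'm \<Rightarrow> 'm" where
  "app f x = (THE y. pair x y \<^bold>\<in> f)"

definition empty :: 'm where
  "empty = (THE z. \<forall>x. \<not> x \<^bold>\<in> z)"

definition succ :: "'m \<Rightarrow> 'm" where
  "succ x = (THE s. \<forall>u. u \<^bold>\<in> s \<longleftrightarrow> u \<^bold>\<in> x \<or> u = x)"

definition is_inductive :: "'m \<Rightarrow> bool" where
  "is_inductive w \<longleftrightarrow> empty \<^bold>\<in> w \<and> (\<forall>x. x \<^bold>\<in> w \<longrightarrow> succ x \<^bold>\<in> w)"

definition omega :: 'm where
  "omega = (THE w. is_inductive w \<and>
                   (\<forall>v. is_inductive v \<longrightarrow> (\<forall>x. x \<^bold>\<in> w \<longrightarrow> x \<^bold>\<in> v)))"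

text \<open>
  A set \<open>k\<close> of the model with operations (graphs of functions, also elements of the model) viewed as
  a ring, and likewise a set \<open>v\<close> viewed as a module.  The fields \<open>mult\<close> and \<open>one\<close> of the module
  record, inherited from rings, play no role in the predicate \<^const>\<open>module\<close>.
\<close>

definition ring_of :: "'m \<Rightarrow> 'm \<Rightarrow> 'm \<Rightarrow> 'm \<Rightarrow> 'm \<Rightarrow> 'm ring" where
  "ring_of k ad mu z u =
     \<lparr>carrier = elems k, mult = (\<lambda>x y. app mu (pair x y)), one = u,
      zero = z, add = (\<lambda>x y. app ad (pair x y))\<rparr>"

definition module_of :: "'m \<Rightarrow> 'm \<Rightarrow> 'm \<Rightarrow> 'm \<Rightarrow> ('m, 'm) module" where
  "module_of v ad scale z =
     \<lparr>carrier = elems v, mult = undefined, one = undefined,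
      zero = z, add = (\<lambda>x y. app ad (pair x y)), smult = (\<lambda>q x. app scale (pair q x))\<rparr>"

text \<open>
  The field of rational numbers, fixed up to isomorphism as the field of fractions of the integers:
  \<open>i\<close> embeds the natural numbers injectively, and every element is a quotient
  \<open>(i m - i n) / i d\<close> with \<open>d\<close> nonzero.
\<close>

definition rationals :: "'m \<Rightarrow> 'm \<Rightarrow> 'm \<Rightarrow> 'm \<Rightarrow> 'm \<Rightarrow> bool" where
  "rationals k ad mu z u \<longleftrightarrow>
     func ad (cross k k) k \<and> func mu (cross k k) k \<and>
     (let K = ring_of k ad mu z u in
        field K \<and>
        (\<exists>i. func i omega k \<and>
             app i empty = \<zero>\<^bsub>K\<^esub> \<and>
             (\<forall>n. n \<^bold>\<in> omega \<longrightarrow> app i (succ n) = app i n \<oplus>\<^bsub>K\<^esub> \<one>\<^bsub>K\<^esub>) \<and>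
             (\<forall>m n. m \<^bold>\<in> omega \<longrightarrow> n \<^bold>\<in> omega \<longrightarrow> app i m = app i n \<longrightarrow> m = n) \<and>
             (\<forall>q. q \<^bold>\<in> k \<longrightarrow>
                (\<exists>m n d. m \<^bold>\<in> omega \<and> n \<^bold>\<in> omega \<and> d \<^bold>\<in> omega \<and> d \<noteq> empty \<and>
                         q \<otimes>\<^bsub>K\<^esub> app i d = app i m \<ominus>\<^bsub>K\<^esub> app i n))))"

definition vector_space_over ::
    "'m \<Rightarrow> 'm ring \<Rightarrow> 'm \<Rightarrow> 'm \<Rightarrow> 'm \<Rightarrow> 'm \<Rightarrow> bool" where
  "vector_space_over k K v ad scale z \<longleftrightarrow>
     func ad (cross v v) v \<and> func scale (cross k v) v \<and>
     field K \<and> module K (module_of v ad scale z)"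

text \<open>
  \<open>x\<close> is the sum of \<open>f b \<cdot> b\<close> over \<open>b \<in> B\<close>, where \<open>f\<close> has finite support: \<open>e\<close> enumerates without
  repetition finitely many elements of \<open>B\<close>, among them the whole support of \<open>f\<close>, and \<open>p\<close> is the
  sequence of partial sums.  Finiteness is that of the model: \<open>n = {0, \<dots>, n - 1}\<close> is an element of
  its \<open>\<omega>\<close>, which need not be a standard natural number.
\<close>

definition lincomb :: "'m ring \<Rightarrow> 'm \<Rightarrow> ('m, 'm) module \<Rightarrow> 'm \<Rightarrow> 'm \<Rightarrow> 'm \<Rightarrow> bool" where
  "lincomb K v V B f x \<longleftrightarrow>
     (\<exists>n e p. n \<^bold>\<in> omega \<and> func e n B \<and>
        (\<forall>j l. j \<^bold>\<in> n \<longrightarrow> l \<^bold>\<in> n \<longrightarrow> app e j = app e l \<longrightarrow> j = l) \<and>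
        (\<forall>b. b \<^bold>\<in> B \<longrightarrow> app f b \<noteq> \<zero>\<^bsub>K\<^esub> \<longrightarrow> (\<exists>j. j \<^bold>\<in> n \<and> app e j = b)) \<and>
        func p (succ n) v \<and> app p empty = \<zero>\<^bsub>V\<^esub> \<and>
        (\<forall>j. j \<^bold>\<in> n \<longrightarrow>
           app p (succ j) = app p j \<oplus>\<^bsub>V\<^esub> (app f (app e j) \<odot>\<^bsub>V\<^esub> app e j)) \<and>
        app p n = x)"

definition basis :: "'m \<Rightarrow> 'm ring \<Rightarrow> 'm \<Rightarrow> ('m, 'm) module \<Rightarrow> 'm \<Rightarrow> bool" where
  "basis k K v V B \<longleftrightarrow>
     (\<forall>b. b \<^bold>\<in> B \<longrightarrow> b \<^bold>\<in> v) \<and>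
     (\<forall>x. x \<^bold>\<in> v \<longrightarrow> (\<exists>f. func f B k \<and> lincomb K v V B f x)) \<and>
     (\<forall>f. func f B k \<and> lincomb K v V B f \<zero>\<^bsub>V\<^esub> \<longrightarrow>
        (\<forall>b. b \<^bold>\<in> B \<longrightarrow> app f b = \<zero>\<^bsub>K\<^esub>))"

definition is_subset :: "'m \<Rightarrow> 'm \<Rightarrow> bool" where
  "is_subset a b \<longleftrightarrow> (\<forall>x. x \<^bold>\<in> a \<longrightarrow> x \<^bold>\<in> b)"

definition two_elements :: "'m \<Rightarrow> bool" where
  "two_elements a \<longleftrightarrow> (\<exists>x y. x \<noteq> y \<and> a = upair x y)"

definition sumset :: "('m, 'm) module \<Rightarrow> 'm \<Rightarrow> 'm" where
  "sumset V a = (THE s. \<forall>w. w \<^bold>\<in> s \<longleftrightarrow> (\<exists>x y. x \<^bold>\<in> a \<and> y \<^bold>\<in> a \<and> w = x \<oplus>\<^bsub>V\<^esub> y))"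

definition monochromatic :: "'m \<Rightarrow> 'm \<Rightarrow> bool" where
  "monochromatic c s \<longleftrightarrow> (\<forall>x y. x \<^bold>\<in> s \<longrightarrow> y \<^bold>\<in> s \<longrightarrow> app c x = app c y)"

end

end

theory Submission
  imports Defs
begin

text \<open>
  Fix a basis and let \<open>N x\<close> be the sum of the squares of the coordinates of \<open>x\<close>.  This is a positive
  definite quadratic form with values in the rationals, and it treats all basis vectors alike, so
  that no ordering of the basis is involved.  The colour of \<open>x\<close> is a natural number that
  determines \<open>N x\<close>; such numbers exist because the rationals are countable without any choice.  If
  \<open>x + x\<close>, \<open>x + y\<close> and \<open>y + y\<close> have the same colour, the parallelogram law
  \<open>N (2x) + N (2y) = 2 N (x + y) + 2 N (x - y)\<close> gives \<open>2 N (x - y) = 0\<close>, and \<open>x = y\<close> because \<open>N\<close> is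
  definite (\<open>colour_separates\<close>).

  The colouring has to be an element of the given model of ZF, and the \<open>\<omega>\<close> of that model may
  contain nonstandard numbers.  So HOL can neither define the colouring nor add up coordinates:
  functions are obtained by separation, and statements about finite sums are proved by induction
  in the model.  Both require predicates that are definable by formulas with parameters.  The
  predicate \<open>dfn\<close> expresses this semantically and has closure rules for all logical connectives, so
  that \<open>intro\<close> proves the definability of each predicate used, without exhibiting its formula.

  Evaluation of a finitely supported coefficient function \<open>f\<close> to the vector \<open>\<Sum> f b \<cdot> b\<close>, and to the
  rational number \<open>\<Sum> (f b)\<^sup>2\<close>, are two instances of the same \<^const>\<open>lincomb\<close>, taken with the maps
  \<open>(q, b) \<mapsto> q \<cdot> b\<close> and \<open>(q, b) \<mapsto> q\<^sup>2\<close> in the place of scalar multiplication; the locale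
  \<open>finite_sums\<close> treats them together.  The sum is given there by an enumeration of the
  support, which raises the question whether it depends on the enumeration.  Two facts avoid all
  rearrangements of sums: changing \<open>f\<close> at one basis vector changes the sum by the difference of the
  two terms (\<open>lin_update\<close>), and every finitely supported function arises from zero by such
  changes (\<open>support_induct\<close>).  Uniqueness of sums, additivity, positivity and the parallelogram law
  all follow by checking that a change at one basis vector preserves them.
\<close>

section \<open>Predicates definable in a model\<close>

lemma sat_rename: "\<exists>q. \<forall>e. sat mem e q \<longleftrightarrow> sat mem (\<lambda>n. e (f n)) p"
proof (induction p arbitrary: f)
  case (FMem i j)
  then show ?case by (intro exI[of _ "FMem (f i) (f j)"]) simp
next
  case (FEq i j)
  then show ?case by (intro exI[of _ "FEq (f i) (f j)"]) simp
next
  case (FNeg p)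
  obtain q where "\<forall>e. sat mem e q \<longleftrightarrow> sat mem (\<lambda>n. e (f n)) p" using FNeg[of f] by (rule exE)
  then show ?case by (intro exI[of _ "FNeg q"]) simp
next
  case (FAnd p1 p2)
  obtain q1 where "\<forall>e. sat mem e q1 \<longleftrightarrow> sat mem (\<lambda>n. e (f n)) p1" using FAnd(1)[of f] by (rule exE)
  moreover obtain q2 where "\<forall>e. sat mem e q2 \<longleftrightarrow> sat mem (\<lambda>n. e (f n)) p2"
    using FAnd(2)[of f] by (rule exE)
  ultimately show ?case by (intro exI[of _ "FAnd q1 q2"]) simp
next
  case (FEx p)
  obtain q where q: "\<forall>e. sat mem e q \<longleftrightarrow> sat mem (\<lambda>n. e (case_nat 0 (\<lambda>k. Suc (f k)) n)) p"
    using FEx[of "case_nat 0 (\<lambda>k. Suc (f k))"] by (rule exE)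
  have *: "(\<lambda>n. case_nat x e (case_nat 0 (\<lambda>k. Suc (f k)) n)) = case_nat x (\<lambda>n. e (f n))" for x e
    by (auto split: nat.split)
  have "sat mem (case_nat x e) q \<longleftrightarrow> sat mem (case_nat x (\<lambda>n. e (f n))) p" for x e
    using q[rule_format, of "case_nat x e"] by (simp only: *)
  then show ?case by (intro exI[of _ "FEx q"]) simp
qed

context ZF_model
begin

text \<open>
  Definability with parameters.  The assignment \<open>\<sigma>\<close> sends each variable of the formula either to
  a variable of the environment (\<^const>\<open>Inl\<close>) or to a parameter from the model (\<^const>\<open>Inr\<close>).
  Keeping parameters apart from the environment makes every element of the model a definable
  constant.
\<close>
definition dfn :: "((nat \<Rightarrow> 'm) \<Rightarrow> bool) \<Rightarrow> bool" where
  "dfn P \<longleftrightarrow> (\<exists>p \<sigma>. \<forall>e. P e \<longleftrightarrow> sat mem (\<lambda>n. case \<sigma> n of Inl i \<Rightarrow> e i | Inr a \<Rightarrow> a) p)"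

text \<open>
  A HOL function of the environment is definable if its graph is; position \<open>0\<close> of the environment
  holds the value, and the arguments move up by one.
\<close>
definition dterm :: "((nat \<Rightarrow> 'm) \<Rightarrow> 'm) \<Rightarrow> bool" where
  "dterm t \<longleftrightarrow> dfn (\<lambda>e. e 0 = t (\<lambda>n. e (Suc n)))"

lemma dfnE:
  assumes "dfn P"
  obtains p \<sigma> where "\<forall>e. P e \<longleftrightarrow> sat mem (\<lambda>n. case \<sigma> n of Inl i \<Rightarrow> e i | Inr a \<Rightarrow> a) p"
  using assms unfolding dfn_def by blast

lemma dfn_not: "dfn P \<Longrightarrow> dfn (\<lambda>e. \<not> P e)"
  proof -
  assume "dfn P"
  then obtain p \<sigma> where "\<And>e. P e \<longleftrightarrow> sat mem (\<lambda>n. case \<sigma> n of Inl i \<Rightarrow> e i | Inr a \<Rightarrow> a) p"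
    unfolding dfn_def by blast
  then show ?thesis unfolding dfn_def by (intro exI[of _ "FNeg p"] exI[of _ \<sigma>]) simp
qed

text \<open>
  The two formulas may use the same variable for different parameters, so their variables are
  first made disjoint: those of the first become even, those of the second odd.
\<close>
lemma dfn_conj:
  assumes "dfn P" "dfn Q" shows "dfn (\<lambda>e. P e \<and> Q e)"
proof -
  obtain p \<sigma> where p: "\<And>e. P e \<longleftrightarrow> sat mem (\<lambda>n. case \<sigma> n of Inl i \<Rightarrow> e i | Inr a \<Rightarrow> a) p"
    using assms(1) unfolding dfn_def by blast
  obtain q \<tau> where q: "\<And>e. Q e \<longleftrightarrow> sat mem (\<lambda>n. case \<tau> n of Inl i \<Rightarrow> e i | Inr a \<Rightarrow> a) q"
    using assms(2) unfolding dfn_def by blast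
  obtain p' where p': "\<forall>e. sat mem e p' \<longleftrightarrow> sat mem (\<lambda>n. e (2 * n)) p" using sat_rename by blast
  obtain q' where q': "\<forall>e. sat mem e q' \<longleftrightarrow> sat mem (\<lambda>n. e (2 * n + 1)) q"
    using sat_rename[of mem "\<lambda>n. 2 * n + 1" q] by blast
  show ?thesis unfolding dfn_def
    by (rule exI[of _ "FAnd p' q'"],
        rule exI[of _ "\<lambda>n. if even n then \<sigma> (n div 2) else \<tau> (n div 2)"]) (simp add: p q p' q')
qed

lemma dfn_reindex:
  assumes "dfn P" shows "dfn (\<lambda>e. P (\<lambda>n. e (f n)))"
proof -
  obtain p \<sigma> where p: "\<And>e. P e \<longleftrightarrow> sat mem (\<lambda>n. case \<sigma> n of Inl i \<Rightarrow> e i | Inr a \<Rightarrow> a) p"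
    using assms(1) unfolding dfn_def by blast
  have *: "(\<lambda>n. case map_sum f id (\<sigma> n) of Inl i \<Rightarrow> e i | Inr a \<Rightarrow> a) =
      (\<lambda>n. case \<sigma> n of Inl i \<Rightarrow> e (f i) | Inr a \<Rightarrow> a)" for e :: "nat \<Rightarrow> 'm"
    by (auto split: sum.split)
  show ?thesis unfolding dfn_def
    by (rule exI[of _ p], rule exI[of _ "\<lambda>n. map_sum f id (\<sigma> n)"]) (simp add: p *)
qed

text \<open>
  The de Bruijn variable \<open>0\<close> of the new quantifier has to be shared by all variables of the formula
  that denote position \<open>0\<close> of the environment; this is the renaming in the proof.  The premise is
  written so that, used backwards, it turns a bound variable into a position of the environment.
\<close>
lemma dfn_ex:
  assumes "dfn (\<lambda>e. P (\<lambda>n. e (Suc n)) (e 0))" shows "dfn (\<lambda>e. \<exists>x. P e x)"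
proof -
  obtain p \<sigma> where p: "\<And>e. P (\<lambda>n. e (Suc n)) (e 0) \<longleftrightarrow>
      sat mem (\<lambda>n. case \<sigma> n of Inl i \<Rightarrow> e i | Inr a \<Rightarrow> a) p"
    using assms(1) unfolding dfn_def by blast
  obtain p' where p': "\<forall>e. sat mem e p' \<longleftrightarrow> sat mem (\<lambda>n. e (if \<sigma> n = Inl 0 then 0 else Suc n)) p"
    using sat_rename[of mem "\<lambda>n. if \<sigma> n = Inl 0 then 0 else Suc n" p] by blast
  define \<tau> where "\<tau> = (\<lambda>n. case \<sigma> n of Inl 0 \<Rightarrow> Inl 0 | Inl (Suc i) \<Rightarrow> Inl i | Inr a \<Rightarrow> Inr a)"
  have "(\<lambda>n. case_nat x (\<lambda>n. case \<tau> n of Inl i \<Rightarrow> e i | Inr a \<Rightarrow> a) (if \<sigma> n = Inl 0 then 0 else Suc n))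
      = (\<lambda>n. case \<sigma> n of Inl i \<Rightarrow> case_nat x e i | Inr a \<Rightarrow> a)" for x e
    by (auto simp: \<tau>_def split: sum.split nat.split)
  then have "P e x \<longleftrightarrow> sat mem (case_nat x (\<lambda>n. case \<tau> n of Inl i \<Rightarrow> e i | Inr a \<Rightarrow> a)) p'" for e x
    using p[of "case_nat x e"] by (simp add: p')
  then have "(\<exists>x. P e x) \<longleftrightarrow> sat mem (\<lambda>n. case \<tau> n of Inl i \<Rightarrow> e i | Inr a \<Rightarrow> a) (FEx p')" for e
    unfolding sat.simps by (rule ex_cong1)
  then show ?thesis unfolding dfn_def by blast
qed

lemma dfn_mem_var: "dfn (\<lambda>e. mem (e i) (e j))"
  unfolding dfn_def by (rule exI[of _ "FMem i j"], rule exI[of _ Inl]) simp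

lemma dfn_eq_var: "dfn (\<lambda>e. e i = e j)"
  unfolding dfn_def by (rule exI[of _ "FEq i j"], rule exI[of _ Inl]) simp

lemma dterm_var: "dterm (\<lambda>e. e i)"
  unfolding dterm_def by (rule dfn_eq_var)

lemma dterm_const: "dterm (\<lambda>e. a)"
  unfolding dterm_def dfn_def
  by (rule exI[of _ "FEq 0 1"], rule exI[of _ "\<lambda>n. if n = 0 then Inl 0 else Inr a"]) simp

lemma dfn_const: "dfn (\<lambda>e. c)"
proof (cases c)
  case True
  then show ?thesis unfolding dfn_def
    by (intro exI[of _ "FEq 0 0"] exI[of _ Inl]) simp
next
  case False
  then show ?thesis unfolding dfn_def
    by (intro exI[of _ "FNeg (FEq 0 0)"] exI[of _ Inl]) simp
qed

lemma dfn_disj: assumes "dfn P" "dfn Q" shows "dfn (\<lambda>e. P e \<or> Q e)"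
  using dfn_not[OF dfn_conj[OF dfn_not[OF assms(1)] dfn_not[OF assms(2)]]] by simp

lemma dfn_imp: assumes "dfn P" "dfn Q" shows "dfn (\<lambda>e. P e \<longrightarrow> Q e)"
  unfolding imp_conv_disj by (intro dfn_disj dfn_not assms)

lemma dfn_iff: assumes "dfn P" "dfn Q" shows "dfn (\<lambda>e. P e \<longleftrightarrow> Q e)"
  unfolding iff_conv_conj_imp by (intro dfn_conj dfn_imp assms)

lemma dfn_all: assumes "dfn (\<lambda>e. P (\<lambda>n. e (Suc n)) (e 0))" shows "dfn (\<lambda>e. \<forall>x. P e x)"
  using dfn_not[OF dfn_ex[of "\<lambda>e x. \<not> P e x", OF dfn_not[OF assms]]] by simp

text \<open>
  Definable terms may be substituted into definable relations, since \<open>R t\<close> means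
  \<open>\<exists>x. x = t \<and> R x\<close>.
\<close>
lemma dfn_subst1:
  assumes R: "dfn (\<lambda>e. R (e 0))" and t: "dterm t"
  shows "dfn (\<lambda>e. R (t e))"
proof -
  have "dfn (\<lambda>e. \<exists>x. x = t e \<and> R x)"
    by (rule dfn_ex, rule dfn_conj, rule t[unfolded dterm_def], rule R)
  then show ?thesis by simp
qed

lemma dfn_subst2:
  assumes R: "dfn (\<lambda>e. R (e 0) (e 1))" and t: "dterm t" and s: "dterm s"
  shows "dfn (\<lambda>e. R (t e) (s e))"
proof -
  have "dfn (\<lambda>e. \<exists>x y. x = t e \<and> y = s e \<and> R x y)"
    using dfn_reindex[OF t[unfolded dterm_def], of "\<lambda>n. Suc n"]
      dfn_reindex[OF s[unfolded dterm_def], of "case_nat 0 (\<lambda>n. Suc (Suc n))"]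
      dfn_reindex[OF R, of "\<lambda>n. if n = 0 then 1 else 0"]
    by (intro dfn_ex dfn_conj) simp_all
  then show ?thesis by simp
qed

lemma dfn_subst3:
  assumes R: "dfn (\<lambda>e. R (e 0) (e 1) (e 2))" and t: "dterm t" and s: "dterm s" and r: "dterm r"
  shows "dfn (\<lambda>e. R (t e) (s e) (r e))"
proof -
  have "dfn (\<lambda>e. \<exists>x y z. x = t e \<and> y = s e \<and> z = r e \<and> R x y z)"
    using dfn_reindex[OF t[unfolded dterm_def], of "\<lambda>n. Suc (Suc n)"]
      dfn_reindex[OF s[unfolded dterm_def], of "case_nat 1 (\<lambda>n. Suc (Suc (Suc n)))"]
      dfn_reindex[OF r[unfolded dterm_def], of "case_nat 0 (\<lambda>n. Suc (Suc (Suc n)))"]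
      dfn_reindex[OF R, of "\<lambda>n. if n = 0 then 2 else if n = 1 then 1 else 0"]
    by (intro dfn_ex dfn_conj) (simp_all add: numeral_2_eq_2)
  then show ?thesis by simp
qed

lemma dterm_reindex: "dterm t \<Longrightarrow> dterm (\<lambda>e. t (\<lambda>n. e (f n)))"
  unfolding dterm_def
  using dfn_reindex[of "\<lambda>e. e 0 = t (\<lambda>n. e (Suc n))" "case_nat 0 (\<lambda>n. Suc (f n))"] by simp

lemma dterm_fun1:
  assumes R: "dfn (\<lambda>e. R (e 0) (e 1))" and eq: "\<And>z x. z = F x \<longleftrightarrow> R z x" and "dterm t"
  shows "dterm (\<lambda>e. F (t e))"
  unfolding dterm_def eq
  by (rule dfn_subst2[OF R dterm_var dterm_reindex[OF \<open>dterm t\<close>]])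

lemma dterm_fun2:
  assumes R: "dfn (\<lambda>e. R (e 0) (e 1) (e 2))" and eq: "\<And>z x y. z = F x y \<longleftrightarrow> R z x y"
    and "dterm t" "dterm s"
  shows "dterm (\<lambda>e. F (t e) (s e))"
  unfolding dterm_def eq
  by (rule dfn_subst3[OF R dterm_var dterm_reindex[OF \<open>dterm t\<close>] dterm_reindex[OF \<open>dterm s\<close>]])

lemma dfn_mem: "dterm t \<Longrightarrow> dterm s \<Longrightarrow> dfn (\<lambda>e. mem (t e) (s e))"
  by (rule dfn_subst2[where R = mem, OF dfn_mem_var])

lemma dfn_eq: "dterm t \<Longrightarrow> dterm s \<Longrightarrow> dfn (\<lambda>e. t e = s e)"
  by (rule dfn_subst2[where R = "(=)", OF dfn_eq_var])

lemmas dfn_intros = dfn_const dterm_const dterm_var dfn_not dfn_conj dfn_disj dfn_imp dfn_iff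
  dfn_ex dfn_all dfn_mem dfn_eq

text \<open>
  The separation scheme for definable predicates.  All variables that denote the element are
  identified with variable \<open>0\<close>, and the parameters become the values of the remaining ones.
\<close>
lemma separation_dfn:
  assumes "dfn (\<lambda>e. P (e 0))"
  shows "\<exists>b. \<forall>x. mem x b \<longleftrightarrow> mem x a \<and> P x"
proof -
  obtain p \<sigma> where p: "\<forall>e :: nat \<Rightarrow> 'm. P (e 0) \<longleftrightarrow> sat mem (\<lambda>n. case \<sigma> n of Inl i \<Rightarrow> e i | Inr a \<Rightarrow> a) p"
    by (rule dfnE[OF assms])
  define f where "f = (\<lambda>n. case \<sigma> n of Inl _ \<Rightarrow> 0 | Inr _ \<Rightarrow> Suc n)"
  obtain q where q: "\<forall>e. sat mem e q \<longleftrightarrow> sat mem (\<lambda>n. e (f n)) p" using sat_rename by blast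
  define e where "e = (\<lambda>n. case \<sigma> n of Inl _ \<Rightarrow> undefined | Inr a \<Rightarrow> a)"
  have "(\<lambda>n. case_nat x e (f n)) = (\<lambda>n. case \<sigma> n of Inl i \<Rightarrow> x | Inr a \<Rightarrow> a)" for x
    by (auto simp: f_def e_def split: sum.split)
  then have "P x \<longleftrightarrow> sat mem (case_nat x e) q" for x
    using p[rule_format, of "\<lambda>_. x"] by (simp add: q)
  with separation[of a e q] show ?thesis by simp
qed

end

section \<open>Sets, functions and natural numbers of a model\<close>

context ZF_model
begin

abbreviation opair  ("\<langle>_, _\<rangle>") where "\<langle>x, y\<rangle> \<equiv> pair mem x y"
abbreviation appl (infixl "\<cdot>" 90) where "f \<cdot> x \<equiv> app mem f x"
abbreviation maps ("_ : _ \<leadsto> _" [51, 51, 51] 50) where "f : a \<leadsto> b \<equiv> func mem f a b"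
abbreviation times_set (infixr "\<times>\<^sub>m" 80) where "a \<times>\<^sub>m b \<equiv> cross mem a b"
abbreviation zero_ord ("\<emptyset>") where "\<emptyset> \<equiv> empty mem"
abbreviation suc_ord where "suc_ord n \<equiv> succ mem n"
abbreviation nats ("\<omega>") where "\<omega> \<equiv> omega mem"

lemma ex_uniq_set: "\<exists>a. \<forall>x. x \<^bold>\<in> a \<longleftrightarrow> P x \<Longrightarrow> x \<^bold>\<in> (THE a. \<forall>x. x \<^bold>\<in> a \<longleftrightarrow> P x) \<longleftrightarrow> P x"
proof -
  assume "\<exists>a. \<forall>x. x \<^bold>\<in> a \<longleftrightarrow> P x"
  then have "\<exists>!a. \<forall>x. x \<^bold>\<in> a \<longleftrightarrow> P x" by (rule ex_ex1I) (rule extensionality, simp)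
  then have "\<forall>x. x \<^bold>\<in> (THE a. \<forall>x. x \<^bold>\<in> a \<longleftrightarrow> P x) \<longleftrightarrow> P x" by (rule theI')
  then show ?thesis by blast
qed

lemma mem_upair: "x \<^bold>\<in> upair mem a b \<longleftrightarrow> x = a \<or> x = b"
  unfolding upair_def by (rule ex_uniq_set[OF pairing])

lemma eq_upair: "u = upair mem a b \<longleftrightarrow> (\<forall>x. x \<^bold>\<in> u \<longleftrightarrow> x = a \<or> x = b)"
  by (auto simp: mem_upair intro: extensionality)

lemma upair_eq: "upair mem a b = upair mem c d \<longleftrightarrow> a = c \<and> b = d \<or> a = d \<and> b = c"
  by (auto simp: eq_upair mem_upair)

lemma pair_eq [simp]: "\<langle>a, b\<rangle> = \<langle>c, d\<rangle> \<longleftrightarrow> a = c \<and> b = d"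
  unfolding pair_def by (auto simp: upair_eq)

lemma not_mem_empty [simp]: "\<not> x \<^bold>\<in> \<emptyset>"
proof -
  obtain b where "\<forall>x. x \<^bold>\<in> b \<longleftrightarrow> False"
    using separation_dfn[OF dfn_const[of False], of undefined] by auto
  then have "\<exists>!z. \<forall>x. \<not> x \<^bold>\<in> z" by (auto intro: extensionality)
  then have "\<forall>x. \<not> x \<^bold>\<in> (THE z. \<forall>x. \<not> x \<^bold>\<in> z)" by (rule theI')
  then show ?thesis unfolding empty_def by blast
qed

lemma eq_empty: "z = \<emptyset> \<longleftrightarrow> (\<forall>x. \<not> x \<^bold>\<in> z)"
  by (auto intro: extensionality)

lemma binary_union: "\<exists>u. \<forall>x. x \<^bold>\<in> u \<longleftrightarrow> x \<^bold>\<in> a \<or> x \<^bold>\<in> b"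
  using union[of "upair mem a b"] unfolding mem_upair by metis

lemma mem_succ [simp]: "u \<^bold>\<in> suc_ord x \<longleftrightarrow> u \<^bold>\<in> x \<or> u = x"
proof -
  have "\<exists>s. \<forall>u. u \<^bold>\<in> s \<longleftrightarrow> u \<^bold>\<in> x \<or> u = x"
    using binary_union[of x "upair mem x x"] by (simp add: mem_upair)
  then show ?thesis unfolding succ_def by (rule ex_uniq_set)
qed

lemma eq_succ: "s = suc_ord x \<longleftrightarrow> (\<forall>u. u \<^bold>\<in> s \<longleftrightarrow> u \<^bold>\<in> x \<or> u = x)"
  by (auto intro: extensionality)

lemma dterm_upair: "dterm t \<Longrightarrow> dterm s \<Longrightarrow> dterm (\<lambda>e. upair mem (t e) (s e))"
  by (rule dterm_fun2[OF _ eq_upair]) (intro dfn_intros)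

lemma dterm_pair: "dterm t \<Longrightarrow> dterm s \<Longrightarrow> dterm (\<lambda>e. \<langle>t e, s e\<rangle>)"
  unfolding pair_def by (intro dterm_upair)

lemma dterm_succ: "dterm t \<Longrightarrow> dterm (\<lambda>e. suc_ord (t e))"
  by (rule dterm_fun1[OF _ eq_succ]) (intro dfn_intros)

lemma dfn_ex1: "dfn (\<lambda>e. \<exists>x. P e x \<and> (\<forall>y. P e y \<longrightarrow> y = x)) \<Longrightarrow> dfn (\<lambda>e. \<exists>!x. P e x)"
  unfolding Ex1_def .

text \<open>
  Where \<open>f\<close> is not a function at \<open>x\<close>, \<^const>\<open>app\<close> is an unspecified value that no formula
  describes.  The totalised application is definable, and it agrees with \<^const>\<open>app\<close> on arguments
  in the domain of a function (\<open>func_dapp\<close>).  It replaces \<^const>\<open>app\<close> in all predicates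
  that have to be definable.
\<close>
definition dapp :: "'m \<Rightarrow> 'm \<Rightarrow> 'm" where
  "dapp f x = (if \<exists>!y. \<langle>x, y\<rangle> \<^bold>\<in> f then f \<cdot> x else \<emptyset>)"

lemma eq_dapp: "y = dapp f x \<longleftrightarrow> (\<langle>x, y\<rangle> \<^bold>\<in> f \<and> (\<exists>!y. \<langle>x, y\<rangle> \<^bold>\<in> f)) \<or> (\<not> (\<exists>!y. \<langle>x, y\<rangle> \<^bold>\<in> f) \<and> y = \<emptyset>)"
  unfolding dapp_def app_def using theI'[of "\<lambda>y. \<langle>x, y\<rangle> \<^bold>\<in> f"] by auto

lemma dterm_dapp: "dterm t \<Longrightarrow> dterm s \<Longrightarrow> dterm (\<lambda>e. dapp (t e) (s e))"
  by (rule dterm_fun2[OF _ eq_dapp]) (intro dfn_intros dfn_ex1 dterm_pair)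

lemma dfn_func:
  assumes "dterm t" "dterm s" "dterm r"
  shows "dfn (\<lambda>e. t e : s e \<leadsto> r e)"
  by (rule dfn_subst3[where R = "func mem", OF _ assms])
    (unfold func_def, intro dfn_intros dfn_ex1 dterm_pair)

lemmas zf_dfn_intros = dfn_intros dfn_ex1 dterm_pair dterm_succ dterm_dapp dfn_func

text \<open>
  The pairs lie in the second power set of the union of the two sets, where separation applies.
\<close>
lemma mem_cross: "u \<^bold>\<in> a \<times>\<^sub>m b \<longleftrightarrow> (\<exists>x y. x \<^bold>\<in> a \<and> y \<^bold>\<in> b \<and> u = \<langle>x, y\<rangle>)"
proof -
  obtain w where w: "\<forall>x. x \<^bold>\<in> w \<longleftrightarrow> x \<^bold>\<in> a \<or> x \<^bold>\<in> b" using binary_union by blast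
  obtain p where p: "\<forall>x. x \<^bold>\<in> p \<longleftrightarrow> (\<forall>y. y \<^bold>\<in> x \<longrightarrow> y \<^bold>\<in> w)" using power_set by blast
  obtain q where q: "\<forall>x. x \<^bold>\<in> q \<longleftrightarrow> (\<forall>y. y \<^bold>\<in> x \<longrightarrow> y \<^bold>\<in> p)" using power_set by blast
  have "dfn (\<lambda>e. \<exists>x y. x \<^bold>\<in> a \<and> y \<^bold>\<in> b \<and> e 0 = \<langle>x, y\<rangle>)" by (intro zf_dfn_intros)
  then obtain c where c: "\<forall>u. u \<^bold>\<in> c \<longleftrightarrow> u \<^bold>\<in> q \<and> (\<exists>x y. x \<^bold>\<in> a \<and> y \<^bold>\<in> b \<and> u = \<langle>x, y\<rangle>)"
    using separation_dfn[of "\<lambda>u. \<exists>x y. x \<^bold>\<in> a \<and> y \<^bold>\<in> b \<and> u = \<langle>x, y\<rangle>" q] by blast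
  have "\<langle>x, y\<rangle> \<^bold>\<in> q" if "x \<^bold>\<in> a" "y \<^bold>\<in> b" for x y
    using that by (auto simp: q p w pair_def mem_upair)
  then have "\<exists>c. \<forall>u. u \<^bold>\<in> c \<longleftrightarrow> (\<exists>x y. x \<^bold>\<in> a \<and> y \<^bold>\<in> b \<and> u = \<langle>x, y\<rangle>)"
    using c by (intro exI[of _ c]) blast
  then show ?thesis unfolding cross_def by (rule ex_uniq_set)
qed

lemma pair_mem_cross [simp]: "\<langle>x, y\<rangle> \<^bold>\<in> a \<times>\<^sub>m b \<longleftrightarrow> x \<^bold>\<in> a \<and> y \<^bold>\<in> b"
  by (auto simp: mem_cross)

lemma func_pair: "f : a \<leadsto> b \<Longrightarrow> x \<^bold>\<in> a \<Longrightarrow> \<langle>x, y\<rangle> \<^bold>\<in> f \<longleftrightarrow> f \<cdot> x = y"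
  unfolding app_def func_def by (metis (mono_tags, lifting) theI')

lemma func_app: "f : a \<leadsto> b \<Longrightarrow> x \<^bold>\<in> a \<Longrightarrow> f \<cdot> x \<^bold>\<in> b"
  using func_pair[of f a b x "f \<cdot> x"] unfolding func_def by fastforce

lemma func_dapp: "f : a \<leadsto> b \<Longrightarrow> x \<^bold>\<in> a \<Longrightarrow> dapp f x = f \<cdot> x"
  unfolding dapp_def func_def by simp

lemma func_ext:
  assumes f: "f : a \<leadsto> b" and g: "g : a \<leadsto> c" and eq: "\<And>x. x \<^bold>\<in> a \<Longrightarrow> f \<cdot> x = g \<cdot> x"
  shows "f = g"
proof (rule extensionality)
  fix u
  have "u \<^bold>\<in> f \<longleftrightarrow> (\<exists>x. x \<^bold>\<in> a \<and> u = \<langle>x, f \<cdot> x\<rangle>)"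
    using f func_pair[OF f] unfolding func_def by metis
  moreover have "u \<^bold>\<in> g \<longleftrightarrow> (\<exists>x. x \<^bold>\<in> a \<and> u = \<langle>x, g \<cdot> x\<rangle>)"
    using g func_pair[OF g] unfolding func_def by metis
  ultimately show "u \<^bold>\<in> f \<longleftrightarrow> u \<^bold>\<in> g" using eq by metis
qed

text \<open>
  The way in which all functions of the model are obtained: \<open>t\<close> is an arbitrary HOL function, and
  only the relation \<open>R\<close>, which has to describe its graph on the domain, needs to be definable.
\<close>
lemma func_exists:
  assumes R: "dfn (\<lambda>e. R (e 0) (e 1))"
    and t: "\<And>x. x \<^bold>\<in> a \<Longrightarrow> t x \<^bold>\<in> b"
    and Rt: "\<And>x y. x \<^bold>\<in> a \<Longrightarrow> y \<^bold>\<in> b \<Longrightarrow> R x y \<longleftrightarrow> y = t x"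
  obtains f where "f : a \<leadsto> b" "\<And>x. x \<^bold>\<in> a \<Longrightarrow> f \<cdot> x = t x"
proof -
  have "dfn (\<lambda>e. \<exists>x y. e 0 = \<langle>x, y\<rangle> \<and> R x y)"
    by (intro zf_dfn_intros dfn_subst2[where R = R, OF R])
  then obtain f where f: "\<forall>u. u \<^bold>\<in> f \<longleftrightarrow> u \<^bold>\<in> a \<times>\<^sub>m b \<and> (\<exists>x y. u = \<langle>x, y\<rangle> \<and> R x y)"
    using separation_dfn[of "\<lambda>u. \<exists>x y. u = \<langle>x, y\<rangle> \<and> R x y" "a \<times>\<^sub>m b"] by blast
  have pf: "\<langle>x, y\<rangle> \<^bold>\<in> f \<longleftrightarrow> y = t x" if "x \<^bold>\<in> a" for x y
    using f Rt[of x y] t that by auto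
  have fn: "f : a \<leadsto> b"
    unfolding func_def using f pf by (auto simp: mem_cross)
  then show thesis using that pf func_pair[OF fn] by blast
qed

lemma not_mem_self: "\<not> x \<^bold>\<in> x"
  using foundation[of "upair mem x x"] by (auto simp: mem_upair)

lemma not_mem_cycle: "x \<^bold>\<in> y \<Longrightarrow> \<not> y \<^bold>\<in> x"
  using foundation[of "upair mem x y"] by (auto simp: mem_upair)

text \<open>
  The intersection of all inductive sets, formed inside one that the axiom of infinity provides.
\<close>
lemma omega_props: "is_inductive mem \<omega> \<and> (\<forall>v. is_inductive mem v \<longrightarrow> (\<forall>x. x \<^bold>\<in> \<omega> \<longrightarrow> x \<^bold>\<in> v))"
proof -
  obtain w where w: "\<exists>z. z \<^bold>\<in> w \<and> (\<forall>x. \<not> x \<^bold>\<in> z)"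
    "\<forall>x. x \<^bold>\<in> w \<longrightarrow> (\<exists>s. s \<^bold>\<in> w \<and> (\<forall>u. u \<^bold>\<in> s \<longleftrightarrow> u \<^bold>\<in> x \<or> u = x))" using infinity by blast
  have iw: "is_inductive mem w"
    unfolding is_inductive_def using w eq_empty eq_succ by metis
  have "dfn (\<lambda>e. \<forall>v. is_inductive mem v \<longrightarrow> e 0 \<^bold>\<in> v)"
    unfolding is_inductive_def by (intro zf_dfn_intros)
  then obtain N where N: "\<forall>x. x \<^bold>\<in> N \<longleftrightarrow> x \<^bold>\<in> w \<and> (\<forall>v. is_inductive mem v \<longrightarrow> x \<^bold>\<in> v)"
    using separation_dfn[of "\<lambda>x. \<forall>v. is_inductive mem v \<longrightarrow> x \<^bold>\<in> v"] by blast
  have ind: "\<emptyset> \<^bold>\<in> v" "x \<^bold>\<in> v \<Longrightarrow> suc_ord x \<^bold>\<in> v" if "is_inductive mem v" for v x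
    using that unfolding is_inductive_def by auto
  have "is_inductive mem N" unfolding is_inductive_def[of _ N] using ind iw N by simp
  then have "\<exists>!w. is_inductive mem w \<and> (\<forall>v. is_inductive mem v \<longrightarrow> (\<forall>x. x \<^bold>\<in> w \<longrightarrow> x \<^bold>\<in> v))"
    using N by (intro ex1I[of _ N] conjI extensionality) (assumption, simp, iprover)
  then show ?thesis unfolding omega_def by (rule theI')
qed

lemma zero_omega [simp]: "\<emptyset> \<^bold>\<in> \<omega>" and succ_omega [simp]: "n \<^bold>\<in> \<omega> \<Longrightarrow> suc_ord n \<^bold>\<in> \<omega>"
  using omega_props[THEN conjunct1] unfolding is_inductive_def by auto

lemma omega_induct [consumes 2, case_names zero suc]:
  assumes P: "dfn (\<lambda>e. P (e 0))" and n: "n \<^bold>\<in> \<omega>"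
    and "P \<emptyset>" "\<And>n. n \<^bold>\<in> \<omega> \<Longrightarrow> P n \<Longrightarrow> P (suc_ord n)"
  shows "P n"
proof -
  obtain b where b: "\<forall>x. x \<^bold>\<in> b \<longleftrightarrow> x \<^bold>\<in> \<omega> \<and> P x" using separation_dfn[OF P] by blast
  then have "is_inductive mem b" unfolding is_inductive_def using assms by simp
  then show ?thesis using omega_props[THEN conjunct2, rule_format, of b n] n b by simp
qed

lemma omega_cases: assumes "n \<^bold>\<in> \<omega>" shows "n = \<emptyset> \<or> (\<exists>m. m \<^bold>\<in> \<omega> \<and> n = suc_ord m)"
  by (rule omega_induct[where P = "\<lambda>n. n = \<emptyset> \<or> (\<exists>m. m \<^bold>\<in> \<omega> \<and> n = suc_ord m)", OF _ assms])
    (intro zf_dfn_intros, auto)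

lemma succ_neq_empty [simp]: "suc_ord n \<noteq> \<emptyset>" "\<emptyset> \<noteq> suc_ord n"
  by (metis mem_succ not_mem_empty)+

lemma succ_inject [simp]: "suc_ord m = suc_ord n \<longleftrightarrow> m = n"
  by (metis mem_succ not_mem_cycle)

lemma omega_transitive:
  assumes "n \<^bold>\<in> \<omega>" shows "\<forall>x y. x \<^bold>\<in> n \<longrightarrow> y \<^bold>\<in> x \<longrightarrow> y \<^bold>\<in> n"
  by (rule omega_induct[where P = "\<lambda>n. \<forall>x y. x \<^bold>\<in> n \<longrightarrow> y \<^bold>\<in> x \<longrightarrow> y \<^bold>\<in> n", OF _ assms])
    (intro zf_dfn_intros, auto)

lemma mem_omega: assumes "n \<^bold>\<in> \<omega>" "x \<^bold>\<in> n" shows "x \<^bold>\<in> \<omega>"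
proof -
  have "\<forall>x. x \<^bold>\<in> n \<longrightarrow> x \<^bold>\<in> \<omega>"
    by (rule omega_induct[where P = "\<lambda>n. \<forall>x. x \<^bold>\<in> n \<longrightarrow> x \<^bold>\<in> \<omega>", OF _ assms(1)])
      (intro zf_dfn_intros, auto)
  with assms(2) show ?thesis by blast
qed

lemma empty_mem_succ: assumes "n \<^bold>\<in> \<omega>" shows "\<emptyset> \<^bold>\<in> suc_ord n"
  by (rule omega_induct[where P = "\<lambda>n. \<emptyset> \<^bold>\<in> suc_ord n", OF _ assms])
    (intro zf_dfn_intros, auto)

lemma succ_mem_succ: assumes "n \<^bold>\<in> \<omega>" shows "\<forall>m. m \<^bold>\<in> n \<longrightarrow> suc_ord m \<^bold>\<in> suc_ord n"
  by (rule omega_induct[where P = "\<lambda>n. \<forall>m. m \<^bold>\<in> n \<longrightarrow> suc_ord m \<^bold>\<in> suc_ord n", OF _ assms])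
    (intro zf_dfn_intros, auto)

lemma omega_trichotomy:
  assumes "n \<^bold>\<in> \<omega>" "m \<^bold>\<in> \<omega>" shows "m \<^bold>\<in> n \<or> m = n \<or> n \<^bold>\<in> m"
proof -
  have "\<forall>m. m \<^bold>\<in> \<omega> \<longrightarrow> m \<^bold>\<in> n \<or> m = n \<or> n \<^bold>\<in> m"
  proof (rule omega_induct[where P = "\<lambda>n. \<forall>m. m \<^bold>\<in> \<omega> \<longrightarrow> m \<^bold>\<in> n \<or> m = n \<or> n \<^bold>\<in> m", OF _ assms(1)])
    show "dfn (\<lambda>e. \<forall>m. m \<^bold>\<in> \<omega> \<longrightarrow> m \<^bold>\<in> e 0 \<or> m = e 0 \<or> e 0 \<^bold>\<in> m)" by (intro zf_dfn_intros)
  next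
    show "\<forall>m. m \<^bold>\<in> \<omega> \<longrightarrow> m \<^bold>\<in> \<emptyset> \<or> m = \<emptyset> \<or> \<emptyset> \<^bold>\<in> m" using empty_mem_succ by auto
  next
    fix n assume "n \<^bold>\<in> \<omega>" "\<forall>m. m \<^bold>\<in> \<omega> \<longrightarrow> m \<^bold>\<in> n \<or> m = n \<or> n \<^bold>\<in> m"
    then show "\<forall>m. m \<^bold>\<in> \<omega> \<longrightarrow> m \<^bold>\<in> suc_ord n \<or> m = suc_ord n \<or> suc_ord n \<^bold>\<in> m"
      using succ_mem_succ by auto
  qed
  with assms show ?thesis by blast
qed

end

section \<open>Finitely supported functions and finite sums\<close>

context ZF_model
begin

lemma func_update:
  assumes h: "h : B \<leadsto> k" and r: "r \<^bold>\<in> k"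
  obtains g where "g : B \<leadsto> k" "\<And>c. c \<^bold>\<in> B \<Longrightarrow> g \<cdot> c = (if c = b then r else h \<cdot> c)"
proof (rule func_exists[of "\<lambda>c y. (c = b \<and> y = r) \<or> (c \<noteq> b \<and> y = dapp h c)" B
        "\<lambda>c. if c = b then r else h \<cdot> c" k])
  show "dfn (\<lambda>e. (e 0 = b \<and> e 1 = r) \<or> (e 0 \<noteq> b \<and> e 1 = dapp h (e 0)))"
    by (intro zf_dfn_intros)
qed (use h r in \<open>auto simp: func_dapp func_app intro: that\<close>)

lemma mem_of_succ_mem_succ: "n \<^bold>\<in> \<omega> \<Longrightarrow> suc_ord j \<^bold>\<in> suc_ord n \<Longrightarrow> j \<^bold>\<in> n"
  using omega_transitive[of n] by (metis mem_succ)

lemma mem_succ_self: "n \<^bold>\<in> suc_ord n"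
  by simp

definition fin_enum :: "'m \<Rightarrow> 'm \<Rightarrow> 'm \<Rightarrow> bool" where
  "fin_enum n e B \<longleftrightarrow> n \<^bold>\<in> \<omega> \<and> e : n \<leadsto> B \<and>
     (\<forall>j l. j \<^bold>\<in> n \<longrightarrow> l \<^bold>\<in> n \<longrightarrow> e \<cdot> j = e \<cdot> l \<longrightarrow> j = l)"

text \<open>
  Finiteness is that of the model: \<open>n\<close> may be nonstandard.
\<close>
definition fin_supp :: "'m \<Rightarrow> 'm \<Rightarrow> 'm \<Rightarrow> bool" where
  "fin_supp B \<zeta> f \<longleftrightarrow> (\<exists>n e. fin_enum n e B \<and>
     (\<forall>b. b \<^bold>\<in> B \<longrightarrow> f \<cdot> b \<noteq> \<zeta> \<longrightarrow> (\<exists>j. j \<^bold>\<in> n \<and> e \<cdot> j = b)))"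

text \<open>
  Let \<open>e\<close> enumerate the support of \<open>f\<close>.  Induction on \<open>j\<close> shows that \<open>P\<close> holds for every function
  that agrees with \<open>f\<close> at the first \<open>j\<close> places of \<open>e\<close> and is \<open>\<zeta>\<close> elsewhere.  The enumeration has no
  repetitions, so the value at the next place is still \<open>\<zeta>\<close> when it is changed; positivity of sums
  of squares depends on this.
\<close>
lemma support_induct:
  assumes P: "dfn (\<lambda>e. P (e 0))" and f: "f : B \<leadsto> k" and fin: "fin_supp B \<zeta> f" and \<zeta>: "\<zeta> \<^bold>\<in> k"
    and zero: "\<And>h. h : B \<leadsto> k \<Longrightarrow> (\<And>b. b \<^bold>\<in> B \<Longrightarrow> h \<cdot> b = \<zeta>) \<Longrightarrow> P h"
    and step: "\<And>g h b. g : B \<leadsto> k \<Longrightarrow> h : B \<leadsto> k \<Longrightarrow> b \<^bold>\<in> B \<Longrightarrow> g \<cdot> b = \<zeta> \<Longrightarrow>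
       (\<And>c. c \<^bold>\<in> B \<Longrightarrow> c \<noteq> b \<Longrightarrow> h \<cdot> c = g \<cdot> c) \<Longrightarrow> P g \<Longrightarrow> P h"
  shows "P f"
proof -
  obtain n e where n: "n \<^bold>\<in> \<omega>" and e: "e : n \<leadsto> B"
    and inj: "\<And>j l. j \<^bold>\<in> n \<Longrightarrow> l \<^bold>\<in> n \<Longrightarrow> e \<cdot> j = e \<cdot> l \<Longrightarrow> j = l"
    and cov: "\<And>b. b \<^bold>\<in> B \<Longrightarrow> f \<cdot> b \<noteq> \<zeta> \<Longrightarrow> \<exists>j. j \<^bold>\<in> n \<and> e \<cdot> j = b"
    using fin unfolding fin_supp_def fin_enum_def by blast
  define restr where "restr j h \<longleftrightarrow> (\<forall>b. b \<^bold>\<in> B \<longrightarrow>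
      ((\<exists>l. l \<^bold>\<in> j \<and> dapp e l = b) \<and> dapp h b = dapp f b) \<or>
      (\<not> (\<exists>l. l \<^bold>\<in> j \<and> dapp e l = b) \<and> dapp h b = \<zeta>))" for j h
  define C where "C j \<longleftrightarrow> (j \<^bold>\<in> suc_ord n \<longrightarrow> (\<forall>h. h : B \<leadsto> k \<longrightarrow> restr j h \<longrightarrow> P h))" for j
  \<comment> \<open>Quantifying over all functions that satisfy the restriction, instead of naming the
    restricted function, keeps the induction hypothesis definable.\<close>
  have "dfn (\<lambda>e. C (e 0))"
    unfolding C_def restr_def by (intro zf_dfn_intros dfn_subst1[where R = P, OF P])
  then have "C n"
  proof (rule omega_induct[OF _ n])
    show "C \<emptyset>" unfolding C_def restr_def by (auto intro!: zero simp: func_dapp)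
  next
    fix j assume j: "j \<^bold>\<in> \<omega>" and IH: "C j"
    show "C (suc_ord j)" unfolding C_def
    proof (intro impI allI)
      fix h assume jn: "suc_ord j \<^bold>\<in> suc_ord n" and h: "h : B \<leadsto> k" and r: "restr (suc_ord j) h"
      have j': "j \<^bold>\<in> n" using mem_of_succ_mem_succ[OF n jn] .
      define b where "b = e \<cdot> j"
      have b: "b \<^bold>\<in> B" unfolding b_def using func_app[OF e j'] .
      obtain g where g: "g : B \<leadsto> k" and gc: "\<And>c. c \<^bold>\<in> B \<Longrightarrow> g \<cdot> c = (if c = b then \<zeta> else h \<cdot> c)"
        by (rule func_update[OF h \<zeta>, of b]) (rule that)
      have ej: "dapp e l = e \<cdot> l" if "l \<^bold>\<in> suc_ord j" for l
        using that j' omega_transitive[OF n] func_dapp[OF e] by auto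
      have lb: "e \<cdot> l \<noteq> b" if "l \<^bold>\<in> j" for l
        using inj[of l j] that j' omega_transitive[OF n] not_mem_self unfolding b_def by blast
      have "restr j g"
        unfolding restr_def
      proof (intro allI impI)
        fix c assume c: "c \<^bold>\<in> B"
        show "((\<exists>l. l \<^bold>\<in> j \<and> dapp e l = c) \<and> dapp g c = dapp f c) \<or>
            (\<not> (\<exists>l. l \<^bold>\<in> j \<and> dapp e l = c) \<and> dapp g c = \<zeta>)"
        proof (cases "c = b")
          case True
          then show ?thesis using lb ej gc[OF c] func_dapp[OF g c] by auto
        next
          case False
          then have "(\<exists>l. l \<^bold>\<in> suc_ord j \<and> dapp e l = c) \<longleftrightarrow> (\<exists>l. l \<^bold>\<in> j \<and> dapp e l = c)"
            using ej unfolding b_def by auto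
          then show ?thesis using r[unfolded restr_def, rule_format, OF c] False
            by (simp only: func_dapp[OF h c] func_dapp[OF g c] gc[OF c] if_False)
        qed
      qed
      moreover have "j \<^bold>\<in> suc_ord n" using j' by simp
      ultimately have "P g" using IH g unfolding C_def by blast
      then show "P h" using step[OF g h b] gc b by auto
    qed
  qed
  moreover have "restr n f"
    unfolding restr_def using cov func_dapp[OF f] func_dapp[OF e] by metis
  ultimately show "P f" unfolding C_def using f by simp
qed

text \<open>
  Two finitely supported functions are built up one after the other: first \<open>f\<close> next to the zero
  function, then \<open>g\<close> next to \<open>f\<close>.
\<close>
lemma support_induct2:
  assumes P: "dfn (\<lambda>e. P (e 0) (e 1))" and f: "f : B \<leadsto> k" "fin_supp B \<zeta> f"
    and g: "g : B \<leadsto> k" "fin_supp B \<zeta> g" and \<zeta>: "\<zeta> \<^bold>\<in> k"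
    and zero: "\<And>f g. f : B \<leadsto> k \<Longrightarrow> g : B \<leadsto> k \<Longrightarrow>
       (\<And>b. b \<^bold>\<in> B \<Longrightarrow> f \<cdot> b = \<zeta>) \<Longrightarrow> (\<And>b. b \<^bold>\<in> B \<Longrightarrow> g \<cdot> b = \<zeta>) \<Longrightarrow> P f g"
    and step: "\<And>f g f' g' b. f : B \<leadsto> k \<Longrightarrow> g : B \<leadsto> k \<Longrightarrow> f' : B \<leadsto> k \<Longrightarrow> g' : B \<leadsto> k \<Longrightarrow> b \<^bold>\<in> B \<Longrightarrow>
       (\<And>c. c \<^bold>\<in> B \<Longrightarrow> c \<noteq> b \<Longrightarrow> f' \<cdot> c = f \<cdot> c) \<Longrightarrow>
       (\<And>c. c \<^bold>\<in> B \<Longrightarrow> c \<noteq> b \<Longrightarrow> g' \<cdot> c = g \<cdot> c) \<Longrightarrow> P f g \<Longrightarrow> P f' g'"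
  shows "P f g"
proof -
  define Z where "Z h \<longleftrightarrow> h : B \<leadsto> k \<and> (\<forall>b. b \<^bold>\<in> B \<longrightarrow> dapp h b = \<zeta>)" for h
  have Z: "Z h \<longleftrightarrow> h : B \<leadsto> k \<and> (\<forall>b. b \<^bold>\<in> B \<longrightarrow> h \<cdot> b = \<zeta>)" for h
    unfolding Z_def using func_dapp by metis
  have left: "\<forall>h. Z h \<longrightarrow> P f h"
  proof (rule support_induct[where P = "\<lambda>f. \<forall>h. Z h \<longrightarrow> P f h", OF _ f \<zeta>])
    show "dfn (\<lambda>e. \<forall>h. Z h \<longrightarrow> P (e 0) h)"
      unfolding Z_def by (intro zf_dfn_intros dfn_subst2[where R = P, OF P])
  next
    show "\<forall>h. Z h \<longrightarrow> P f h" if "f : B \<leadsto> k" "\<And>b. b \<^bold>\<in> B \<Longrightarrow> f \<cdot> b = \<zeta>" for f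
      unfolding Z using zero that by simp
  next
    show "\<forall>h. Z h \<longrightarrow> P f' h" if "f : B \<leadsto> k" "f' : B \<leadsto> k" "b \<^bold>\<in> B"
      "\<And>c. c \<^bold>\<in> B \<Longrightarrow> c \<noteq> b \<Longrightarrow> f' \<cdot> c = f \<cdot> c" "\<forall>h. Z h \<longrightarrow> P f h" for f f' b
    proof (intro allI impI)
      fix h assume "Z h"
      then have "h : B \<leadsto> k" "P f h" using that(5) unfolding Z by auto
      then show "P f' h" using step[OF that(1) _ that(2) _ that(3,4)] by blast
    qed
  qed
  show ?thesis
  proof (rule support_induct[where P = "\<lambda>g. P f g", OF _ g \<zeta>])
    show "dfn (\<lambda>e. P f (e 0))" by (intro zf_dfn_intros dfn_subst2[where R = P, OF P])
  next
    show "P f h" if "h : B \<leadsto> k" "\<And>b. b \<^bold>\<in> B \<Longrightarrow> h \<cdot> b = \<zeta>" for h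
      using left[rule_format, of h] that unfolding Z by simp
  next
    show "P f h" if "g : B \<leadsto> k" "h : B \<leadsto> k" "b \<^bold>\<in> B" "\<And>c. c \<^bold>\<in> B \<Longrightarrow> c \<noteq> b \<Longrightarrow> h \<cdot> c = g \<cdot> c"
      "P f g" for g h b
      using step[OF f(1) that(1) f(1) that(2,3) _ that(4,5)] by blast
  qed
qed

end

lemma (in abelian_group) add_diff_swap:
  assumes "a \<in> carrier G" "u \<in> carrier G" "v \<in> carrier G"
  shows "(a \<oplus> u) \<oplus> (v \<ominus> u) = a \<oplus> v"
proof -
  have "v \<ominus> u = \<ominus> u \<oplus> v" using assms by (simp add: minus_eq a_comm)
  then show ?thesis using assms by (simp add: a_assoc r_neg2)
qed

text \<open>
  The setting for \<^const>\<open>lincomb\<close> with values in an abelian group \<open>A\<close>.  The map \<open>\<phi>\<close> sends a scalar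
  and a basis vector to a term of the sum.  It vanishes at the scalar zero, but it need not be
  additive, so that \<open>\<phi> (q, b) = q\<^sup>2\<close> is allowed.
\<close>
locale finite_sums = ZF_model mem
  for mem :: "'m \<Rightarrow> 'm \<Rightarrow> bool"  (infix "\<^bold>\<in>" 50) +
  fixes k :: 'm and K :: "'m ring" and A ad \<phi> z C B :: 'm
  assumes zero_k: "\<zero>\<^bsub>K\<^esub> \<^bold>\<in> k"
    and ad: "func mem ad (cross mem A A) A"
    and scale: "func mem \<phi> (cross mem k C) A"
    and B_C: "b \<^bold>\<in> B \<Longrightarrow> b \<^bold>\<in> C"
    and group: "abelian_group (module_of mem A ad \<phi> z)"
    and scale_zero: "b \<^bold>\<in> B \<Longrightarrow> app mem \<phi> (pair mem \<zero>\<^bsub>K\<^esub> b) = z"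
begin

abbreviation M where "M \<equiv> module_of mem A ad \<phi> z"
abbreviation lin where "lin \<equiv> lincomb mem K A M B"

lemma M_simps [simp]:
  "x \<in> carrier M \<longleftrightarrow> x \<^bold>\<in> A" "\<zero>\<^bsub>M\<^esub> = z" "q \<odot>\<^bsub>M\<^esub> x = \<phi> \<cdot> \<langle>q, x\<rangle>" "x \<oplus>\<^bsub>M\<^esub> y = ad \<cdot> \<langle>x, y\<rangle>"
  by (simp_all add: module_of_def elems_def)

lemma ad_closed: "x \<^bold>\<in> A \<Longrightarrow> y \<^bold>\<in> A \<Longrightarrow> ad \<cdot> \<langle>x, y\<rangle> \<^bold>\<in> A"
  using func_app[OF ad] by simp

lemma scale_closed: "q \<^bold>\<in> k \<Longrightarrow> b \<^bold>\<in> B \<Longrightarrow> \<phi> \<cdot> \<langle>q, b\<rangle> \<^bold>\<in> A"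
  using func_app[OF scale] B_C by simp

lemma z_closed: "z \<^bold>\<in> A"
  using abelian_group.axioms(1)[OF group] abelian_monoid.zero_closed by fastforce

lemma lincomb_iff:
  "lin f x \<longleftrightarrow> (\<exists>n e p. fin_enum n e B \<and>
     (\<forall>b. b \<^bold>\<in> B \<longrightarrow> f \<cdot> b \<noteq> \<zero>\<^bsub>K\<^esub> \<longrightarrow> (\<exists>j. j \<^bold>\<in> n \<and> e \<cdot> j = b)) \<and>
     p : suc_ord n \<leadsto> A \<and> p \<cdot> \<emptyset> = z \<and>
     (\<forall>j. j \<^bold>\<in> n \<longrightarrow> p \<cdot> suc_ord j = ad \<cdot> \<langle>p \<cdot> j, \<phi> \<cdot> \<langle>f \<cdot> (e \<cdot> j), e \<cdot> j\<rangle>\<rangle>) \<and>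
     p \<cdot> n = x)"
  unfolding lincomb_def fin_enum_def M_simps by (simp only: conj_assoc)

text \<open>
  The definable form of \<^const>\<open>lincomb\<close>; requiring \<open>f\<close> to be a function makes the two agree.
\<close>
definition dlin :: "'m \<Rightarrow> 'm \<Rightarrow> bool" where
  "dlin f x \<longleftrightarrow> f : B \<leadsto> k \<and> (\<exists>n e p. (n \<^bold>\<in> \<omega> \<and> e : n \<leadsto> B \<and>
     (\<forall>j l. j \<^bold>\<in> n \<longrightarrow> l \<^bold>\<in> n \<longrightarrow> dapp e j = dapp e l \<longrightarrow> j = l)) \<and>
     (\<forall>b. b \<^bold>\<in> B \<longrightarrow> dapp f b \<noteq> \<zero>\<^bsub>K\<^esub> \<longrightarrow> (\<exists>j. j \<^bold>\<in> n \<and> dapp e j = b)) \<and>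
     p : suc_ord n \<leadsto> A \<and> dapp p \<emptyset> = z \<and>
     (\<forall>j. j \<^bold>\<in> n \<longrightarrow> dapp p (suc_ord j) =
        dapp ad \<langle>dapp p j, dapp \<phi> \<langle>dapp f (dapp e j), dapp e j\<rangle>\<rangle>) \<and>
     dapp p n = x)"

lemma dfn_dlin: "dterm t \<Longrightarrow> dterm s \<Longrightarrow> dfn (\<lambda>e. dlin (t e) (s e))"
  by (rule dfn_subst2[where R = dlin]) (unfold dlin_def, intro zf_dfn_intros)

lemma dlin_iff: "dlin f x \<longleftrightarrow> f : B \<leadsto> k \<and> lin f x"
proof (cases "f : B \<leadsto> k")
  case f: True
  show ?thesis unfolding dlin_def lincomb_iff fin_enum_def
  proof (rule arg_cong2[where f = "(\<and>)", OF refl], intro ex_cong1)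
    fix n e p
    let ?L = "\<lambda>a. (n \<^bold>\<in> \<omega> \<and> e : n \<leadsto> B \<and>
     (\<forall>j l. j \<^bold>\<in> n \<longrightarrow> l \<^bold>\<in> n \<longrightarrow> a e j = a e l \<longrightarrow> j = l)) \<and>
     (\<forall>b. b \<^bold>\<in> B \<longrightarrow> a f b \<noteq> \<zero>\<^bsub>K\<^esub> \<longrightarrow> (\<exists>j. j \<^bold>\<in> n \<and> a e j = b)) \<and>
     p : suc_ord n \<leadsto> A \<and> a p \<emptyset> = z \<and>
     (\<forall>j. j \<^bold>\<in> n \<longrightarrow> a p (suc_ord j) = a ad \<langle>a p j, a \<phi> \<langle>a f (a e j), a e j\<rangle>\<rangle>) \<and>
     a p n = x"
    show "?L dapp = ?L (app mem)"
    proof (cases "n \<^bold>\<in> \<omega> \<and> e : n \<leadsto> B \<and> p : suc_ord n \<leadsto> A")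
      case True
      then have n: "n \<^bold>\<in> \<omega>" and e: "e : n \<leadsto> B" and p: "p : suc_ord n \<leadsto> A" by auto
      have 1: "dapp e j = e \<cdot> j" if "j \<^bold>\<in> n" for j using func_dapp[OF e that] .
      have 2: "dapp p j = p \<cdot> j" if "j \<^bold>\<in> suc_ord n" for j using func_dapp[OF p that] .
      have 3: "dapp f j = f \<cdot> j" if "j \<^bold>\<in> B" for j using func_dapp[OF f that] .
      have 4: "dapp \<phi> \<langle>f \<cdot> (e \<cdot> j), e \<cdot> j\<rangle> = \<phi> \<cdot> \<langle>f \<cdot> (e \<cdot> j), e \<cdot> j\<rangle>"
        and 5: "dapp ad \<langle>p \<cdot> j, \<phi> \<cdot> \<langle>f \<cdot> (e \<cdot> j), e \<cdot> j\<rangle>\<rangle> = ad \<cdot> \<langle>p \<cdot> j, \<phi> \<cdot> \<langle>f \<cdot> (e \<cdot> j), e \<cdot> j\<rangle>\<rangle>"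
        if "j \<^bold>\<in> n" for j
      proof -
        have ej: "e \<cdot> j \<^bold>\<in> B" using func_app[OF e that] .
        then have fej: "f \<cdot> (e \<cdot> j) \<^bold>\<in> k" using func_app[OF f] by blast
        show "dapp \<phi> \<langle>f \<cdot> (e \<cdot> j), e \<cdot> j\<rangle> = \<phi> \<cdot> \<langle>f \<cdot> (e \<cdot> j), e \<cdot> j\<rangle>"
          by (rule func_dapp[OF scale]) (use ej fej B_C in simp)
        have "p \<cdot> j \<^bold>\<in> A" using func_app[OF p] that by simp
        then show "dapp ad \<langle>p \<cdot> j, \<phi> \<cdot> \<langle>f \<cdot> (e \<cdot> j), e \<cdot> j\<rangle>\<rangle> = ad \<cdot> \<langle>p \<cdot> j, \<phi> \<cdot> \<langle>f \<cdot> (e \<cdot> j), e \<cdot> j\<rangle>\<rangle>"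
          by (intro func_dapp[OF ad]) (use scale_closed[OF fej ej] in simp)
      qed
      have 6: "f \<cdot> (e \<cdot> j) = dapp f (e \<cdot> j)" if "j \<^bold>\<in> n" for j
        using func_app[OF e that] 3 by simp
      have 7: "dapp p (suc_ord j) = p \<cdot> suc_ord j" "dapp p j = p \<cdot> j" if "j \<^bold>\<in> n" for j
        using 2 succ_mem_succ[OF n] that by auto
      have 8: "dapp p \<emptyset> = p \<cdot> \<emptyset>" "dapp p n = p \<cdot> n" using 2 empty_mem_succ[OF n] by auto
      have 10: "(\<exists>j. j \<^bold>\<in> n \<and> dapp e j = b) \<longleftrightarrow> (\<exists>j. j \<^bold>\<in> n \<and> e \<cdot> j = b)" for b
        using 1 by auto
      show ?thesis unfolding 10
        by (intro arg_cong2[where f = "(\<and>)"] refl all_cong1 imp_cong) (simp_all add: 1 3 7 8 6[symmetric] 4 5)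
    next
      case False
      then show ?thesis by blast
    qed
  qed
next
  case False
  then show ?thesis unfolding dlin_def by simp
qed

lemma lin_closed: "lin f x \<Longrightarrow> x \<^bold>\<in> A"
  unfolding lincomb_iff using func_app mem_succ_self by blast

lemma lin_fin_supp: "lin f x \<Longrightarrow> fin_supp B \<zero>\<^bsub>K\<^esub> f"
  unfolding lincomb_iff fin_supp_def by blast

lemma lin_zero:
  assumes f: "f : B \<leadsto> k" and 0: "\<And>b. b \<^bold>\<in> B \<Longrightarrow> f \<cdot> b = \<zero>\<^bsub>K\<^esub>"
  shows "lin f x \<longleftrightarrow> x = z"
proof
  interpret M: abelian_group M by (rule group)
  assume "lin f x"
  then obtain n e p where n: "n \<^bold>\<in> \<omega>" and e: "e : n \<leadsto> B" and p: "p : suc_ord n \<leadsto> A"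
    and p0: "p \<cdot> \<emptyset> = z" and pn: "p \<cdot> n = x"
    and ps: "\<And>j. j \<^bold>\<in> n \<Longrightarrow> p \<cdot> suc_ord j = ad \<cdot> \<langle>p \<cdot> j, \<phi> \<cdot> \<langle>f \<cdot> (e \<cdot> j), e \<cdot> j\<rangle>\<rangle>"
    unfolding lincomb_iff fin_enum_def by blast
  have "n \<^bold>\<in> suc_ord n \<longrightarrow> dapp p n = z"
  proof (rule omega_induct[where P = "\<lambda>j. j \<^bold>\<in> suc_ord n \<longrightarrow> dapp p j = z", OF _ n])
    show "dfn (\<lambda>e. e 0 \<^bold>\<in> suc_ord n \<longrightarrow> dapp p (e 0) = z)" by (intro zf_dfn_intros)
  next
    show "\<emptyset> \<^bold>\<in> suc_ord n \<longrightarrow> dapp p \<emptyset> = z" using p0 func_dapp[OF p] by auto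
  next
    fix j assume IH: "j \<^bold>\<in> suc_ord n \<longrightarrow> dapp p j = z"
    show "suc_ord j \<^bold>\<in> suc_ord n \<longrightarrow> dapp p (suc_ord j) = z"
    proof
      assume sj: "suc_ord j \<^bold>\<in> suc_ord n"
      then have j: "j \<^bold>\<in> n" using mem_of_succ_mem_succ[OF n] by blast
      then have "p \<cdot> j = z" using IH func_dapp[OF p] by simp
      moreover have "\<phi> \<cdot> \<langle>f \<cdot> (e \<cdot> j), e \<cdot> j\<rangle> = z"
        using func_app[OF e j] 0 scale_zero by simp
      moreover have "ad \<cdot> \<langle>z, z\<rangle> = z" using M.l_zero[of z] z_closed by simp
      ultimately show "dapp p (suc_ord j) = z"
        using ps[OF j] func_dapp[OF p sj] by simp
    qed
  qed
  then show "x = z" using pn func_dapp[OF p] by simp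
next
  assume x: "x = z"
  obtain e where e: "e : \<emptyset> \<leadsto> B"
    using func_exists[of "\<lambda>x y. True" \<emptyset> id B] dfn_const by auto
  obtain p where p: "p : suc_ord \<emptyset> \<leadsto> A" "\<And>j. j \<^bold>\<in> suc_ord \<emptyset> \<Longrightarrow> p \<cdot> j = z"
  proof (rule func_exists[of "\<lambda>x y. y = z" "suc_ord \<emptyset>" "\<lambda>_. z" A])
    show "dfn (\<lambda>e. e 1 = z)" by (intro zf_dfn_intros)
  qed (use z_closed in auto)
  show "lin f x"
    unfolding lincomb_iff fin_enum_def using e p x 0 by (intro exI[of _ \<emptyset>] exI[of _ e] exI[of _ p]) auto
qed

text \<open>
  If \<open>b\<close> occurs in the enumeration, say at \<open>i\<close>, all partial sums after \<open>i\<close> are shifted by the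
  difference of the two terms.  Otherwise \<open>f\<close> is zero at \<open>b\<close>, and \<open>b\<close> is appended to the
  enumeration.
\<close>
lemma lin_update:
  assumes f: "f : B \<leadsto> k" and g: "g : B \<leadsto> k" and b: "b \<^bold>\<in> B"
    and fg: "\<And>c. c \<^bold>\<in> B \<Longrightarrow> c \<noteq> b \<Longrightarrow> g \<cdot> c = f \<cdot> c" and fx: "lin f x"
  shows "lin g (x \<oplus>\<^bsub>M\<^esub> (g \<cdot> b \<odot>\<^bsub>M\<^esub> b \<ominus>\<^bsub>M\<^esub> f \<cdot> b \<odot>\<^bsub>M\<^esub> b))"
proof -
  interpret M: abelian_group M by (rule group)
  obtain n e p where n: "n \<^bold>\<in> \<omega>" and e: "e : n \<leadsto> B" and p: "p : suc_ord n \<leadsto> A"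
    and inj: "\<And>j l. j \<^bold>\<in> n \<Longrightarrow> l \<^bold>\<in> n \<Longrightarrow> e \<cdot> j = e \<cdot> l \<Longrightarrow> j = l"
    and cov: "\<And>b. b \<^bold>\<in> B \<Longrightarrow> f \<cdot> b \<noteq> \<zero>\<^bsub>K\<^esub> \<Longrightarrow> \<exists>j. j \<^bold>\<in> n \<and> e \<cdot> j = b"
    and p0: "p \<cdot> \<emptyset> = z" and pn: "p \<cdot> n = x"
    and ps: "\<And>j. j \<^bold>\<in> n \<Longrightarrow> p \<cdot> suc_ord j = ad \<cdot> \<langle>p \<cdot> j, \<phi> \<cdot> \<langle>f \<cdot> (e \<cdot> j), e \<cdot> j\<rangle>\<rangle>"
    using fx unfolding lincomb_iff fin_enum_def by blast
  have fb: "\<phi> \<cdot> \<langle>f \<cdot> b, b\<rangle> \<^bold>\<in> A" and gb: "\<phi> \<cdot> \<langle>g \<cdot> b, b\<rangle> \<^bold>\<in> A"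
    using scale_closed func_app[OF f b] func_app[OF g b] b by auto
  define d where "d = \<phi> \<cdot> \<langle>g \<cdot> b, b\<rangle> \<ominus>\<^bsub>M\<^esub> \<phi> \<cdot> \<langle>f \<cdot> b, b\<rangle>"
  have d: "d \<^bold>\<in> A" unfolding d_def using M.minus_closed fb gb by simp
  have pA: "p \<cdot> j \<^bold>\<in> A" if "j \<^bold>\<in> suc_ord n" for j using func_app[OF p that] .
  have "lin g (ad \<cdot> \<langle>x, d\<rangle>)"
  proof (cases "\<exists>j. j \<^bold>\<in> n \<and> e \<cdot> j = b")
    case True
    then obtain i where i: "i \<^bold>\<in> n" "e \<cdot> i = b" by blast
    define q' where "q' j = (if j \<^bold>\<in> suc_ord i then p \<cdot> j else ad \<cdot> \<langle>p \<cdot> j, d\<rangle>)" for j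
    obtain q where q: "q : suc_ord n \<leadsto> A" "\<And>j. j \<^bold>\<in> suc_ord n \<Longrightarrow> q \<cdot> j = q' j"
    proof (rule func_exists[of "\<lambda>j y. (j \<^bold>\<in> suc_ord i \<and> y = dapp p j) \<or>
          (\<not> j \<^bold>\<in> suc_ord i \<and> y = dapp ad \<langle>dapp p j, d\<rangle>)" "suc_ord n" q' A])
      show "dfn (\<lambda>e. (e 0 \<^bold>\<in> suc_ord i \<and> e 1 = dapp p (e 0)) \<or>
          (\<not> e 0 \<^bold>\<in> suc_ord i \<and> e 1 = dapp ad \<langle>dapp p (e 0), d\<rangle>))"
        by (intro zf_dfn_intros)
    next
      fix j y assume "j \<^bold>\<in> suc_ord n"
      then show "((j \<^bold>\<in> suc_ord i \<and> y = dapp p j) \<or>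
          (\<not> j \<^bold>\<in> suc_ord i \<and> y = dapp ad \<langle>dapp p j, d\<rangle>)) = (y = q' j)"
        using func_dapp[OF p] func_dapp[OF ad] pA d unfolding q'_def by auto
    qed (use pA d ad_closed in \<open>auto simp: q'_def\<close>)
    have i\<omega>: "i \<^bold>\<in> \<omega>" using mem_omega[OF n i(1)] .
    have qs: "q \<cdot> suc_ord j = ad \<cdot> \<langle>q \<cdot> j, \<phi> \<cdot> \<langle>g \<cdot> (e \<cdot> j), e \<cdot> j\<rangle>\<rangle>" if j: "j \<^bold>\<in> n" for j
    proof -
      have sj: "suc_ord j \<^bold>\<in> suc_ord n" "j \<^bold>\<in> suc_ord n" using succ_mem_succ[OF n] j by auto
      have ej: "e \<cdot> j \<^bold>\<in> B" using func_app[OF e j] .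
      have t: "\<phi> \<cdot> \<langle>f \<cdot> (e \<cdot> j), e \<cdot> j\<rangle> \<^bold>\<in> A" using scale_closed func_app[OF f ej] ej by blast
      consider "j \<^bold>\<in> i" | "j = i" | "\<not> j \<^bold>\<in> suc_ord i" by auto
      then show ?thesis
      proof cases
        case 1
        then have "e \<cdot> j \<noteq> b" using inj[of j i] i j not_mem_self by metis
        then show ?thesis using 1 q(2)[OF sj(1)] q(2)[OF sj(2)] ps[OF j] fg[OF ej]
            succ_mem_succ[OF i\<omega>] unfolding q'_def by simp
      next
        case 2
        have ns: "\<not> suc_ord i \<^bold>\<in> suc_ord i" using not_mem_self by blast
        have "ad \<cdot> \<langle>ad \<cdot> \<langle>p \<cdot> i, \<phi> \<cdot> \<langle>f \<cdot> b, b\<rangle>\<rangle>, d\<rangle> = ad \<cdot> \<langle>p \<cdot> i, \<phi> \<cdot> \<langle>g \<cdot> b, b\<rangle>\<rangle>"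
        proof -
          have "(p \<cdot> i \<oplus>\<^bsub>M\<^esub> \<phi> \<cdot> \<langle>f \<cdot> b, b\<rangle>) \<oplus>\<^bsub>M\<^esub> d = p \<cdot> i \<oplus>\<^bsub>M\<^esub> \<phi> \<cdot> \<langle>g \<cdot> b, b\<rangle>"
            unfolding d_def using fb gb pA[of i] i(1) by (intro M.add_diff_swap) auto
          then show ?thesis by simp
        qed
        then show ?thesis using 2 i q(2)[OF sj(1)] q(2)[OF sj(2)] ps[OF j] ns
          unfolding q'_def by simp
      next
        case 3
        then have "e \<cdot> j \<noteq> b" using inj[of j i] i j by auto
        moreover have "\<not> suc_ord j \<^bold>\<in> suc_ord i"
          using 3 mem_of_succ_mem_succ[OF i\<omega>] by auto
        moreover have "ad \<cdot> \<langle>ad \<cdot> \<langle>p \<cdot> j, t\<rangle>, d\<rangle> = ad \<cdot> \<langle>ad \<cdot> \<langle>p \<cdot> j, d\<rangle>, t\<rangle>" if "t \<^bold>\<in> A" for t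
        proof -
          have "(p \<cdot> j \<oplus>\<^bsub>M\<^esub> t) \<oplus>\<^bsub>M\<^esub> d = (p \<cdot> j \<oplus>\<^bsub>M\<^esub> d) \<oplus>\<^bsub>M\<^esub> t"
            using that d pA[OF sj(2)] by (simp only: M_simps(1) M.a_ac M.a_closed)
          then show ?thesis by simp
        qed
        ultimately show ?thesis using 3 q(2)[OF sj(1)] q(2)[OF sj(2)] ps[OF j] fg[OF ej] t
          unfolding q'_def by simp
      qed
    qed
    have "\<not> n \<^bold>\<in> suc_ord i" using i(1) not_mem_cycle not_mem_self by auto
    then have qn: "q \<cdot> n = ad \<cdot> \<langle>x, d\<rangle>" using q(2)[of n] pn unfolding q'_def by simp
    have q0: "q \<cdot> \<emptyset> = z"
      using q(2)[OF empty_mem_succ[OF n]] p0 empty_mem_succ[OF i\<omega>] unfolding q'_def by simp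
    have "\<exists>j. j \<^bold>\<in> n \<and> e \<cdot> j = c" if "c \<^bold>\<in> B" "g \<cdot> c \<noteq> \<zero>\<^bsub>K\<^esub>" for c
      using that cov[of c] fg[of c] i by (cases "c = b") auto
    then show ?thesis
      unfolding lincomb_iff fin_enum_def using n e inj q(1) q0 qs qn
      by (intro exI[of _ n] exI[of _ e] exI[of _ q]) blast
  next
    case new: False
    then have f0: "f \<cdot> b = \<zero>\<^bsub>K\<^esub>" using cov[OF b] by blast
    have d': "d = \<phi> \<cdot> \<langle>g \<cdot> b, b\<rangle>"
      unfolding d_def f0 using gb scale_zero[OF b] M.minus_eq M.r_zero M.r_neg[OF M.zero_closed]
        M.l_zero[OF M.a_inv_closed[OF M.zero_closed]] by (metis M_simps(1,2))
    have sn: "suc_ord n \<^bold>\<in> \<omega>" using n by simp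
    define e1 where "e1 j = (if j = n then b else e \<cdot> j)" for j
    obtain e' where e': "e' : suc_ord n \<leadsto> B" "\<And>j. j \<^bold>\<in> suc_ord n \<Longrightarrow> e' \<cdot> j = e1 j"
    proof (rule func_exists[of "\<lambda>j y. (j = n \<and> y = b) \<or> (j \<noteq> n \<and> y = dapp e j)" "suc_ord n" e1 B])
      show "dfn (\<lambda>h. (h 0 = n \<and> h 1 = b) \<or> (h 0 \<noteq> n \<and> h 1 = dapp e (h 0)))"
        by (intro zf_dfn_intros)
    qed (use b func_app[OF e] func_dapp[OF e] in \<open>auto simp: e1_def\<close>)
    define q' where "q' j = (if j = suc_ord n then ad \<cdot> \<langle>x, d\<rangle> else p \<cdot> j)" for j
    have xA: "x \<^bold>\<in> A" using lin_closed[OF fx] .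
    obtain q where q: "q : suc_ord (suc_ord n) \<leadsto> A" "\<And>j. j \<^bold>\<in> suc_ord (suc_ord n) \<Longrightarrow> q \<cdot> j = q' j"
    proof (rule func_exists[of "\<lambda>j y. (j = suc_ord n \<and> y = ad \<cdot> \<langle>x, d\<rangle>) \<or> (j \<noteq> suc_ord n \<and> y = dapp p j)"
          "suc_ord (suc_ord n)" q' A])
      show "dfn (\<lambda>h. (h 0 = suc_ord n \<and> h 1 = ad \<cdot> \<langle>x, d\<rangle>) \<or> (h 0 \<noteq> suc_ord n \<and> h 1 = dapp p (h 0)))"
        by (intro zf_dfn_intros)
    next
      show "q' j \<^bold>\<in> A" if "j \<^bold>\<in> suc_ord (suc_ord n)" for j
        using that pA ad_closed[OF xA d] unfolding q'_def by auto
    next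
      show "((j = suc_ord n \<and> y = ad \<cdot> \<langle>x, d\<rangle>) \<or> (j \<noteq> suc_ord n \<and> y = dapp p j)) = (y = q' j)"
        if "j \<^bold>\<in> suc_ord (suc_ord n)" for j y
        using that func_dapp[OF p, of j] unfolding q'_def by auto
    qed (rule that)
    have nm: "j \<noteq> suc_ord n" "j \<noteq> n" if "j \<^bold>\<in> n" for j
      using that not_mem_cycle[of j "suc_ord n"] not_mem_self not_mem_cycle[of j n] by auto
    have inj': "j = l" if "j \<^bold>\<in> suc_ord n" "l \<^bold>\<in> suc_ord n" "e' \<cdot> j = e' \<cdot> l" for j l
      using that inj[of j l] new nm(2) e'(2)[of j] e'(2)[of l] unfolding e1_def
      by (auto split: if_splits)
    have cov': "\<exists>j. j \<^bold>\<in> suc_ord n \<and> e' \<cdot> j = c" if c: "c \<^bold>\<in> B" "g \<cdot> c \<noteq> \<zero>\<^bsub>K\<^esub>" for c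
    proof (cases "c = b")
      case True
      then show ?thesis using e'(2)[of n] unfolding e1_def by (intro exI[of _ n]) simp
    next
      case False
      then obtain j where "j \<^bold>\<in> n" "e \<cdot> j = c" using cov[of c] fg[of c] c by auto
      then show ?thesis using e'(2)[of j] nm(2)[of j] unfolding e1_def by (intro exI[of _ j]) simp
    qed
    have qs: "q \<cdot> suc_ord j = ad \<cdot> \<langle>q \<cdot> j, \<phi> \<cdot> \<langle>g \<cdot> (e' \<cdot> j), e' \<cdot> j\<rangle>\<rangle>" if "j \<^bold>\<in> suc_ord n" for j
    proof (cases "j = n")
      case True
      have "n \<noteq> suc_ord n" using not_mem_self[of n] mem_succ_self[of n] by metis
      then show ?thesis using True e'(2)[of n] q(2)[of n] q(2)[of "suc_ord n"] d' pn
        unfolding e1_def q'_def by simp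
    next
      case False
      then have j: "j \<^bold>\<in> n" using that by simp
      have "suc_ord j \<^bold>\<in> suc_ord n" using succ_mem_succ[OF n] j by blast
      moreover have "e \<cdot> j \<^bold>\<in> B" "e \<cdot> j \<noteq> b" using func_app[OF e j] new j by auto
      ultimately show ?thesis
        using e'(2)[of j] q(2)[of j] q(2)[of "suc_ord j"] ps[OF j] fg[of "e \<cdot> j"] nm[OF j] j False
        unfolding e1_def q'_def by simp
    qed
    have q0: "q \<cdot> \<emptyset> = z" using q(2)[OF empty_mem_succ[OF sn]] p0 unfolding q'_def by simp
    have qn: "q \<cdot> suc_ord n = ad \<cdot> \<langle>x, d\<rangle>" using q(2)[of "suc_ord n"] unfolding q'_def by simp
    show ?thesis
      unfolding lincomb_iff fin_enum_def using sn e'(1) inj' cov' q(1) q0 qs qn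
      by (intro exI[of _ "suc_ord n"] exI[of _ e'] exI[of _ q]) blast
  qed
  then show ?thesis by (simp add: d_def)
qed

text \<open>
  Independence of the enumeration: undoing a change at \<open>b\<close> shifts all sums that belong to the
  changed function by the same amount, to sums of the unchanged function.
\<close>
lemma lin_unique:
  assumes f: "f : B \<leadsto> k" and x: "lin f x" and y: "lin f y"
  shows "x = y"
proof -
  interpret M: abelian_group M by (rule group)
  have "\<forall>x y. dlin f x \<longrightarrow> dlin f y \<longrightarrow> x = y"
  proof (rule support_induct[where P = "\<lambda>f. \<forall>x y. dlin f x \<longrightarrow> dlin f y \<longrightarrow> x = y",
        OF _ f lin_fin_supp[OF x] zero_k])
    show "dfn (\<lambda>e. \<forall>x y. dlin (e 0) x \<longrightarrow> dlin (e 0) y \<longrightarrow> x = y)"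
      by (intro zf_dfn_intros dfn_dlin)
  next
    show "\<forall>x y. dlin h x \<longrightarrow> dlin h y \<longrightarrow> x = y"
      if "h : B \<leadsto> k" "\<And>b. b \<^bold>\<in> B \<Longrightarrow> h \<cdot> b = \<zero>\<^bsub>K\<^esub>" for h
      using lin_zero[OF that] by (simp add: dlin_iff)
  next
    fix g h b assume g: "g : B \<leadsto> k" and h: "h : B \<leadsto> k" and b: "b \<^bold>\<in> B"
      and gh: "\<And>c. c \<^bold>\<in> B \<Longrightarrow> c \<noteq> b \<Longrightarrow> h \<cdot> c = g \<cdot> c"
      and IH: "\<forall>x y. dlin g x \<longrightarrow> dlin g y \<longrightarrow> x = y"
    define d where "d = g \<cdot> b \<odot>\<^bsub>M\<^esub> b \<ominus>\<^bsub>M\<^esub> h \<cdot> b \<odot>\<^bsub>M\<^esub> b"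
    have d: "d \<in> carrier M" unfolding d_def
      using scale_closed func_app[OF g b] func_app[OF h b] b by (intro M.minus_closed) simp_all
    have up: "lin g (x \<oplus>\<^bsub>M\<^esub> d)" if "lin h x" for x
      unfolding d_def by (rule lin_update[OF h g b _ that]) (simp add: gh)
    show "\<forall>x y. dlin h x \<longrightarrow> dlin h y \<longrightarrow> x = y"
    proof (intro allI impI)
      fix x y assume "dlin h x" "dlin h y"
      then have l: "lin h x" "lin h y" by (simp_all add: dlin_iff)
      then have "x \<oplus>\<^bsub>M\<^esub> d = y \<oplus>\<^bsub>M\<^esub> d" using IH up g unfolding dlin_iff by blast
      then show "x = y" using d lin_closed l M.add.right_cancel[of d x y] by (metis M_simps(1))
    qed
  qed
  then show ?thesis using f x y by (simp add: dlin_iff)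
qed

lemma lin_exists:
  assumes f: "f : B \<leadsto> k" and fin: "fin_supp B \<zero>\<^bsub>K\<^esub> f"
  shows "\<exists>x. lin f x"
proof -
  have "\<exists>x. dlin f x"
  proof (rule support_induct[where P = "\<lambda>f. \<exists>x. dlin f x", OF _ f fin zero_k])
    show "dfn (\<lambda>e. \<exists>x. dlin (e 0) x)" by (intro zf_dfn_intros dfn_dlin)
  next
    show "\<exists>x. dlin h x" if "h : B \<leadsto> k" "\<And>b. b \<^bold>\<in> B \<Longrightarrow> h \<cdot> b = \<zero>\<^bsub>K\<^esub>" for h
      using lin_zero[OF that] that by (simp add: dlin_iff)
  next
    show "\<exists>x. dlin h x" if "g : B \<leadsto> k" "h : B \<leadsto> k" "b \<^bold>\<in> B"
      "\<And>c. c \<^bold>\<in> B \<Longrightarrow> c \<noteq> b \<Longrightarrow> h \<cdot> c = g \<cdot> c" "\<exists>x. dlin g x" for g h b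
      using lin_update[OF that(1-4)] that unfolding dlin_iff by blast
  qed
  then show ?thesis by (simp add: dlin_iff)
qed

end

section \<open>The ordered field of rationals and its countability\<close>

lemma (in cring) fraction_sum:
  assumes "s \<in> carrier R" "t \<in> carrier R" "c \<in> carrier R" "d \<in> carrier R"
  shows "(s \<oplus> t) \<otimes> (c \<otimes> d) = (s \<otimes> c) \<otimes> d \<oplus> (t \<otimes> d) \<otimes> c"
  using assms by algebra

lemma (in cring) fraction_square:
  assumes "q \<in> carrier R" "d \<in> carrier R"
  shows "(q \<otimes> q) \<otimes> (d \<otimes> d) = (q \<otimes> d) \<otimes> (q \<otimes> d)"
  using assms by algebra

lemma (in cring) square_diff:
  assumes "n \<in> carrier R" "c \<in> carrier R"
  shows "((n \<oplus> c) \<ominus> n) \<otimes> ((n \<oplus> c) \<ominus> n) = c \<otimes> c" "(n \<ominus> (n \<oplus> c)) \<otimes> (n \<ominus> (n \<oplus> c)) = c \<otimes> c"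
  using assms by algebra+

text \<open>
  With \<open>s = a + b\<close> and \<open>s' = s + (c + 1)\<close>, this writes \<open>s'\<^sup>2 + a'\<close> as \<open>s\<^sup>2 + a\<close> plus a sum of products
  of sums of the given elements.  When these are natural numbers, the pairing function
  \<open>(a, b) \<mapsto> (a + b)\<^sup>2 + a\<close> is seen to be injective without subtraction.
\<close>
lemma (in cring) pairing_expand:
  assumes "a \<in> carrier R" "b \<in> carrier R" "c \<in> carrier R" "a' \<in> carrier R"
  shows "((a \<oplus> b) \<oplus> (c \<oplus> \<one>)) \<otimes> ((a \<oplus> b) \<oplus> (c \<oplus> \<one>)) \<oplus> a' =
    ((a \<oplus> b) \<otimes> (a \<oplus> b) \<oplus> a) \<oplus>
    ((c \<oplus> \<one>) \<otimes> (c \<oplus> \<one>) \<oplus> (b \<oplus> (a \<oplus> b) \<otimes> c \<oplus> (a \<oplus> b) \<otimes> (c \<oplus> \<one>) \<oplus> a'))"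
proof -
  have sq: "(s \<oplus> t) \<otimes> (s \<oplus> t) = s \<otimes> s \<oplus> (s \<otimes> t \<oplus> (s \<otimes> t \<oplus> t \<otimes> t))"
    if "s \<in> carrier R" "t \<in> carrier R" for s t
    using that by (simp add: l_distr r_distr a_assoc m_comm)
  define s t u v where "s = (a \<oplus> b) \<otimes> (a \<oplus> b)" and "t = (a \<oplus> b) \<otimes> (c \<oplus> \<one>)"
    and "u = (c \<oplus> \<one>) \<otimes> (c \<oplus> \<one>)" and "v = (a \<oplus> b) \<otimes> c"
  have car: "s \<in> carrier R" "t \<in> carrier R" "u \<in> carrier R" "v \<in> carrier R"
    unfolding s_def t_def u_def v_def using assms by auto
  have t: "t = v \<oplus> (a \<oplus> b)" unfolding t_def v_def using assms by (simp add: r_distr)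
  have "((a \<oplus> b) \<oplus> (c \<oplus> \<one>)) \<otimes> ((a \<oplus> b) \<oplus> (c \<oplus> \<one>)) \<oplus> a' = s \<oplus> (t \<oplus> (t \<oplus> u)) \<oplus> a'"
    unfolding s_def t_def u_def using assms by (subst sq) auto
  also have "\<dots> = s \<oplus> ((v \<oplus> (a \<oplus> b)) \<oplus> (t \<oplus> u)) \<oplus> a'" by (simp flip: t)
  also have "\<dots> = (s \<oplus> a) \<oplus> (u \<oplus> (b \<oplus> v \<oplus> t \<oplus> a'))"
    using assms car by (simp add: a_ac)
  finally show ?thesis unfolding s_def t_def u_def v_def .
qed

text \<open>
  A field of fractions of the integers, with the embedding \<open>i\<close> of the natural numbers fixed.
\<close>
locale rational_field = ZF_model mem
  for mem :: "'m \<Rightarrow> 'm \<Rightarrow> bool"  (infix "\<^bold>\<in>" 50) +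
  fixes Q ad mu zeroQ oneQ i :: 'm
  assumes ad: "func mem ad (cross mem Q Q) Q"
    and mu: "func mem mu (cross mem Q Q) Q"
    and field: "field (ring_of mem Q ad mu zeroQ oneQ)"
    and i: "func mem i (omega mem) Q"
    and i_zero: "app mem i (empty mem) = zeroQ"
    and i_succ: "n \<^bold>\<in> omega mem \<Longrightarrow> app mem i (succ mem n) = app mem ad (pair mem (app mem i n) oneQ)"
    and i_inj: "m \<^bold>\<in> omega mem \<Longrightarrow> n \<^bold>\<in> omega mem \<Longrightarrow> app mem i m = app mem i n \<Longrightarrow> m = n"
    and quotient: "q \<^bold>\<in> Q \<Longrightarrow> \<exists>m n d. m \<^bold>\<in> omega mem \<and> n \<^bold>\<in> omega mem \<and> d \<^bold>\<in> omega mem \<and>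
        d \<noteq> empty mem \<and> app mem mu (pair mem q (app mem i d)) =
        a_minus (ring_of mem Q ad mu zeroQ oneQ) (app mem i m) (app mem i n)"
begin

text \<open>
  A constant, so that the simplifier does not unfold the record and the laws of fields stay
  applicable.
\<close>
definition K :: "'m ring" where "K = ring_of mem Q ad mu zeroQ oneQ"

abbreviation add_Q (infixl "\<^bold>+" 65) where "x \<^bold>+ y \<equiv> x \<oplus>\<^bsub>K\<^esub> y"
abbreviation mult_Q (infixl "\<^bold>*" 70) where "x \<^bold>* y \<equiv> x \<otimes>\<^bsub>K\<^esub> y"
abbreviation one_Q ("\<^bold>1") where "\<^bold>1 \<equiv> \<one>\<^bsub>K\<^esub>"
abbreviation zero_Q ("\<^bold>0") where "\<^bold>0 \<equiv> \<zero>\<^bsub>K\<^esub>"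

sublocale K: field K
  unfolding K_def by (rule field)

lemma K_carrier [simp]: "x \<in> carrier K \<longleftrightarrow> x \<^bold>\<in> Q"
  by (simp add: K_def ring_of_def elems_def)

lemma K_ops: "x \<^bold>+ y = ad \<cdot> \<langle>x, y\<rangle>" "x \<^bold>* y = mu \<cdot> \<langle>x, y\<rangle>" "\<^bold>0 = zeroQ" "\<^bold>1 = oneQ"
  by (simp_all add: K_def ring_of_def)

lemma Q_closed [simp]:
  "\<^bold>0 \<^bold>\<in> Q" "\<^bold>1 \<^bold>\<in> Q" "x \<^bold>\<in> Q \<Longrightarrow> y \<^bold>\<in> Q \<Longrightarrow> x \<^bold>+ y \<^bold>\<in> Q" "x \<^bold>\<in> Q \<Longrightarrow> y \<^bold>\<in> Q \<Longrightarrow> x \<^bold>* y \<^bold>\<in> Q"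
  using K.zero_closed K.one_closed K.add.m_closed[of x y] K.m_closed[of x y] by auto

lemma quotient': "q \<^bold>\<in> Q \<Longrightarrow> \<exists>m n d. m \<^bold>\<in> \<omega> \<and> n \<^bold>\<in> \<omega> \<and> d \<^bold>\<in> \<omega> \<and> d \<noteq> \<emptyset> \<and>
    q \<^bold>* i \<cdot> d = i \<cdot> m \<ominus>\<^bsub>K\<^esub> i \<cdot> n"
  unfolding K_ops unfolding K_def by (rule quotient)

definition dadd where "dadd x y = dapp ad \<langle>x, y\<rangle>"
definition dmul where "dmul x y = dapp mu \<langle>x, y\<rangle>"

lemma dadd [simp]: "x \<^bold>\<in> Q \<Longrightarrow> y \<^bold>\<in> Q \<Longrightarrow> dadd x y = x \<^bold>+ y"
  unfolding dadd_def K_ops by (rule func_dapp[OF ad]) simp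

lemma dmul [simp]: "x \<^bold>\<in> Q \<Longrightarrow> y \<^bold>\<in> Q \<Longrightarrow> dmul x y = x \<^bold>* y"
  unfolding dmul_def K_ops by (rule func_dapp[OF mu]) simp

lemma dterm_dadd: "dterm t \<Longrightarrow> dterm s \<Longrightarrow> dterm (\<lambda>e. dadd (t e) (s e))"
  unfolding dadd_def by (intro zf_dfn_intros)

lemma dterm_dmul: "dterm t \<Longrightarrow> dterm s \<Longrightarrow> dterm (\<lambda>e. dmul (t e) (s e))"
  unfolding dmul_def by (intro zf_dfn_intros)

text \<open>
  The elements of the field that come from \<open>\<omega>\<close>.  They take the place of \<open>\<omega>\<close> in arithmetic: their
  addition and multiplication are those of the field, so none has to be defined by recursion on \<open>\<omega>\<close>.
\<close>
definition natural :: "'m \<Rightarrow> bool" where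
  "natural a \<longleftrightarrow> (\<exists>n. n \<^bold>\<in> \<omega> \<and> a = dapp i n)"

lemma dfn_natural: "dterm t \<Longrightarrow> dfn (\<lambda>e. natural (t e))"
  by (rule dfn_subst1[where R = natural]) (unfold natural_def, intro zf_dfn_intros)

lemmas q_dfn_intros = zf_dfn_intros dterm_dadd dterm_dmul dfn_natural

lemma dapp_i [simp]: "n \<^bold>\<in> \<omega> \<Longrightarrow> dapp i n = i \<cdot> n"
  by (rule func_dapp[OF i])

lemma i_closed [simp]: "n \<^bold>\<in> \<omega> \<Longrightarrow> i \<cdot> n \<^bold>\<in> Q"
  by (rule func_app[OF i])

lemma i_zer\<zeta> [simp]: "i \<cdot> \<emptyset> = \<^bold>0"
  by (simp add: i_zero K_ops)

lemma i_succ' [simp]: "n \<^bold>\<in> \<omega> \<Longrightarrow> i \<cdot> suc_ord n = i \<cdot> n \<^bold>+ \<^bold>1"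
  by (simp add: i_succ K_ops)

lemma natural_iff: "natural a \<longleftrightarrow> (\<exists>n. n \<^bold>\<in> \<omega> \<and> a = i \<cdot> n)"
  unfolding natural_def using dapp_i by metis

lemma natural_closed [simp]: "natural a \<Longrightarrow> a \<^bold>\<in> Q"
  unfolding natural_iff using i_closed by blast

lemma natural_i [simp]: "n \<^bold>\<in> \<omega> \<Longrightarrow> natural (i \<cdot> n)"
  unfolding natural_iff by blast

lemma natural_induct [consumes 2, case_names zero suc]:
  assumes P: "dfn (\<lambda>e. P (e 0))" and a: "natural a"
    and zero: "P \<^bold>0" and suc: "\<And>a. natural a \<Longrightarrow> P a \<Longrightarrow> P (a \<^bold>+ \<^bold>1)"
  shows "P a"
proof -
  obtain n where n: "n \<^bold>\<in> \<omega>" "a = i \<cdot> n" using a unfolding natural_iff by blast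
  have "P (dapp i n)"
  proof (rule omega_induct[where P = "\<lambda>n. P (dapp i n)", OF _ n(1)])
    show "dfn (\<lambda>e. P (dapp i (e 0)))"
      by (intro zf_dfn_intros dfn_subst1[where R = P, OF P])
  qed (use zero suc in simp_all)
  then show ?thesis using n by simp
qed

lemma natural_zero [simp]: "natural \<^bold>0"
  using natural_i[OF zero_omega] by simp

lemma natural_suc: "natural a \<Longrightarrow> natural (a \<^bold>+ \<^bold>1)"
  unfolding natural_iff by (metis i_succ' succ_omega)

lemma natural_cases: assumes "natural a" shows "a = \<^bold>0 \<or> (\<exists>b. natural b \<and> a = b \<^bold>+ \<^bold>1)"
proof -
  obtain n where n: "n \<^bold>\<in> \<omega>" "a = i \<cdot> n" using assms unfolding natural_iff by blast
  from omega_cases[OF n(1)] show ?thesis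
  proof
    assume "\<exists>m. m \<^bold>\<in> \<omega> \<and> n = suc_ord m"
    then obtain m where "m \<^bold>\<in> \<omega>" "n = suc_ord m" by blast
    then show ?thesis using n(2) by (intro disjI2 exI[of _ "i \<cdot> m"]) simp
  qed (simp add: n(2))
qed

lemma suc_neq_zero: assumes "natural a" shows "a \<^bold>+ \<^bold>1 \<noteq> \<^bold>0"
proof
  assume 0: "a \<^bold>+ \<^bold>1 = \<^bold>0"
  obtain n where n: "n \<^bold>\<in> \<omega>" "a = i \<cdot> n" using assms unfolding natural_iff by blast
  then have "i \<cdot> suc_ord n = i \<cdot> \<emptyset>" using 0 by simp
  then have "suc_ord n = \<emptyset>" using i_inj[of "suc_ord n" \<emptyset>] n by simp
  then show False by simp
qed

lemma natural_add: assumes a: "natural a" and b: "natural b" shows "natural (a \<^bold>+ b)"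
proof -
  have "natural (dadd a b)"
  proof (rule natural_induct[where P = "\<lambda>b. natural (dadd a b)", OF _ b])
    show "dfn (\<lambda>e. natural (dadd a (e 0)))" by (intro q_dfn_intros)
  next
    show "natural (dadd a \<^bold>0)" using a by simp
  next
    fix b assume b: "natural b" "natural (dadd a b)"
    then have "a \<^bold>+ (b \<^bold>+ \<^bold>1) = (a \<^bold>+ b) \<^bold>+ \<^bold>1" using a K.a_assoc[of a b "\<^bold>1"] by simp
    then show "natural (dadd a (b \<^bold>+ \<^bold>1))" using natural_suc[of "a \<^bold>+ b"] a b by simp
  qed
  then show ?thesis using a b by simp
qed

lemma natural_mult: assumes a: "natural a" and b: "natural b" shows "natural (a \<^bold>* b)"
proof -
  have "natural (dmul a b)"
  proof (rule natural_induct[where P = "\<lambda>b. natural (dmul a b)", OF _ b])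
    show "dfn (\<lambda>e. natural (dmul a (e 0)))" by (intro q_dfn_intros)
  next
    show "natural (dmul a \<^bold>0)" using a by simp
  next
    fix b assume b: "natural b" "natural (dmul a b)"
    then have "a \<^bold>* (b \<^bold>+ \<^bold>1) = a \<^bold>* b \<^bold>+ a" using a K.r_distr[of b "\<^bold>1" a] by simp
    then show "natural (dmul a (b \<^bold>+ \<^bold>1))" using natural_add[of "a \<^bold>* b" a] a b by simp
  qed
  then show ?thesis using a b by simp
qed

text \<open>
  A nonzero natural number is a successor, and successors are not zero because \<open>i\<close> is injective.
  The order of the field rests on this fact.
\<close>
lemma natural_add_eq_zero:
  assumes a: "natural a" and b: "natural b" and 0: "a \<^bold>+ b = \<^bold>0" shows "a = \<^bold>0"
proof (cases "b = \<^bold>0")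
  case True
  then show ?thesis using 0 a by simp
next
  case False
  then obtain c where c: "natural c" "b = c \<^bold>+ \<^bold>1" using natural_cases[OF b] by blast
  then have "(a \<^bold>+ c) \<^bold>+ \<^bold>1 = \<^bold>0" using 0 a K.a_assoc[of a c "\<^bold>1"] by simp
  then show ?thesis using suc_neq_zero natural_add[OF a c(1)] by blast
qed

lemma natural_total:
  assumes a: "natural a" and b: "natural b"
  shows "\<exists>c. natural c \<and> (a = b \<^bold>+ c \<or> b = a \<^bold>+ c)"
proof -
  have "\<exists>c. natural c \<and> (a = dadd b c \<or> b = dadd a c)"
  proof (rule natural_induct[where P = "\<lambda>b. \<exists>c. natural c \<and> (a = dadd b c \<or> b = dadd a c)", OF _ b])
    show "dfn (\<lambda>e. \<exists>c. natural c \<and> (a = dadd (e 0) c \<or> e 0 = dadd a c))" by (intro q_dfn_intros)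
  next
    show "\<exists>c. natural c \<and> (a = dadd \<^bold>0 c \<or> \<^bold>0 = dadd a c)"
      using a by (intro exI[of _ a]) simp
  next
    fix b assume b: "natural b" and "\<exists>c. natural c \<and> (a = dadd b c \<or> b = dadd a c)"
    then obtain c where c: "natural c" and abc: "a = b \<^bold>+ c \<or> b = a \<^bold>+ c" using a by auto
    have "\<exists>c. natural c \<and> (a = (b \<^bold>+ \<^bold>1) \<^bold>+ c \<or> b \<^bold>+ \<^bold>1 = a \<^bold>+ c)"
      using abc
    proof
      assume abc: "a = b \<^bold>+ c"
      consider "c = \<^bold>0" | d where "natural d" "c = d \<^bold>+ \<^bold>1" using natural_cases[OF c] by blast
      then show ?thesis
      proof cases
        case 1
        then show ?thesis using abc b natural_suc[OF natural_zero] by (intro exI[of _ "\<^bold>0 \<^bold>+ \<^bold>1"]) simp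
      next
        case 2
        then have "a = (b \<^bold>+ \<^bold>1) \<^bold>+ d"
          using abc b K.a_assoc[of b "\<^bold>1" d] K.a_comm[of d "\<^bold>1"] by simp
        then show ?thesis using 2 by blast
      qed
    next
      assume "b = a \<^bold>+ c"
      then have "b \<^bold>+ \<^bold>1 = a \<^bold>+ (c \<^bold>+ \<^bold>1)" using a c K.a_assoc[of a c "\<^bold>1"] by simp
      then show ?thesis using natural_suc[OF c] by blast
    qed
    then show "\<exists>c. natural c \<and> (a = dadd (b \<^bold>+ \<^bold>1) c \<or> b \<^bold>+ \<^bold>1 = dadd a c)" using a b by auto
  qed
  then show ?thesis using a b by auto
qed

definition nonneg :: "'m \<Rightarrow> bool" where
  "nonneg s \<longleftrightarrow> s \<^bold>\<in> Q \<and> (\<exists>d. natural d \<and> d \<noteq> \<^bold>0 \<and> natural (dmul s d))"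

lemma dfn_nonneg: "dterm t \<Longrightarrow> dfn (\<lambda>e. nonneg (t e))"
  by (rule dfn_subst1[where R = nonneg]) (unfold nonneg_def, intro q_dfn_intros)

lemma nonneg_iff: "nonneg s \<longleftrightarrow> s \<^bold>\<in> Q \<and> (\<exists>d. natural d \<and> d \<noteq> \<^bold>0 \<and> natural (s \<^bold>* d))"
  unfolding nonneg_def by auto

lemma mult_neq_zero: "x \<^bold>\<in> Q \<Longrightarrow> y \<^bold>\<in> Q \<Longrightarrow> x \<noteq> \<^bold>0 \<Longrightarrow> y \<noteq> \<^bold>0 \<Longrightarrow> x \<^bold>* y \<noteq> \<^bold>0"
  using K.integral[of x y] by auto

lemma nonneg_zero: "nonneg \<^bold>0"
proof -
  have "natural (\<^bold>0 \<^bold>+ \<^bold>1)" "\<^bold>0 \<^bold>+ \<^bold>1 \<noteq> \<^bold>0" using natural_suc suc_neq_zero natural_zero by blast+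
  then show ?thesis unfolding nonneg_iff by (intro conjI exI[of _ "\<^bold>0 \<^bold>+ \<^bold>1"]) simp_all
qed

lemma nonneg_add:
  assumes "nonneg s" "nonneg t" shows "nonneg (s \<^bold>+ t)"
proof -
  obtain c d where c: "natural c" "c \<noteq> \<^bold>0" "natural (s \<^bold>* c)" and d: "natural d" "d \<noteq> \<^bold>0" "natural (t \<^bold>* d)"
    and st: "s \<^bold>\<in> Q" "t \<^bold>\<in> Q" using assms unfolding nonneg_iff by blast
  have "natural ((s \<^bold>+ t) \<^bold>* (c \<^bold>* d))"
    using K.fraction_sum[of s t c d] natural_add natural_mult c d st by simp
  moreover have "natural (c \<^bold>* d)" "c \<^bold>* d \<noteq> \<^bold>0" using natural_mult mult_neq_zero c d by auto
  ultimately show ?thesis unfolding nonneg_iff using st by auto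
qed

lemma nonneg_add_eq_zero:
  assumes "nonneg s" "nonneg t" "s \<^bold>+ t = \<^bold>0" shows "s = \<^bold>0"
proof -
  obtain c d where c: "natural c" "c \<noteq> \<^bold>0" "natural (s \<^bold>* c)" and d: "natural d" "d \<noteq> \<^bold>0" "natural (t \<^bold>* d)"
    and st: "s \<^bold>\<in> Q" "t \<^bold>\<in> Q" using assms unfolding nonneg_iff by blast
  have "(s \<^bold>* c) \<^bold>* d \<^bold>+ (t \<^bold>* d) \<^bold>* c = \<^bold>0"
    using K.fraction_sum[of s t c d] c d st assms(3) by simp
  then have "(s \<^bold>* c) \<^bold>* d = \<^bold>0" using natural_add_eq_zero natural_mult c d by blast
  then show "s = \<^bold>0" using mult_neq_zero c d st by (metis Q_closed(4) natural_closed)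
qed

text \<open>
  If \<open>q d = m - n\<close> then \<open>q\<^sup>2 d\<^sup>2 = c\<^sup>2\<close>, where \<open>c\<close> is the natural number \<open>m - n\<close> or \<open>n - m\<close>.
\<close>
lemma nonneg_square: assumes q: "q \<^bold>\<in> Q" shows "nonneg (q \<^bold>* q)"
proof -
  obtain m n d where m: "m \<^bold>\<in> \<omega>" and n: "n \<^bold>\<in> \<omega>" and d: "d \<^bold>\<in> \<omega>" "d \<noteq> \<emptyset>"
    and eq: "q \<^bold>* i \<cdot> d = i \<cdot> m \<ominus>\<^bsub>K\<^esub> i \<cdot> n"
    using quotient'[OF q] by blast
  obtain c where c: "natural c" "i \<cdot> m = i \<cdot> n \<^bold>+ c \<or> i \<cdot> n = i \<cdot> m \<^bold>+ c"
    using natural_total[of "i \<cdot> m" "i \<cdot> n"] m n by auto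
  have "(q \<^bold>* q) \<^bold>* (i \<cdot> d \<^bold>* i \<cdot> d) = c \<^bold>* c"
    using c(2)
  proof
    assume "i \<cdot> m = i \<cdot> n \<^bold>+ c"
    then show ?thesis
      using K.fraction_square[of q "i \<cdot> d"] K.square_diff(1)[of "i \<cdot> n" c] eq q d n c(1) by simp
  next
    assume "i \<cdot> n = i \<cdot> m \<^bold>+ c"
    then show ?thesis
      using K.fraction_square[of q "i \<cdot> d"] K.square_diff(2)[of "i \<cdot> m" c] eq q d m c(1) by simp
  qed
  moreover have "natural (i \<cdot> d \<^bold>* i \<cdot> d)" "natural (c \<^bold>* c)" using natural_mult c d by simp_all
  moreover have "i \<cdot> d \<^bold>* i \<cdot> d \<noteq> \<^bold>0" using i_inj[of d \<emptyset>] d by (intro mult_neq_zero) auto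
  ultimately show ?thesis unfolding nonneg_iff using q by auto
qed

lemma add_left_cancel: "x \<^bold>\<in> Q \<Longrightarrow> y \<^bold>\<in> Q \<Longrightarrow> w \<^bold>\<in> Q \<Longrightarrow> w \<^bold>+ x = w \<^bold>+ y \<longleftrightarrow> x = y"
  using K.add.right_cancel[of w x y] K.a_comm[of w x] K.a_comm[of w y] by simp

lemma pairing_sum_eq:
  assumes nat: "natural a" "natural b" "natural a'" "natural b'" "natural c"
    and sum: "a' \<^bold>+ b' = (a \<^bold>+ b) \<^bold>+ c"
    and eq: "(a \<^bold>+ b) \<^bold>* (a \<^bold>+ b) \<^bold>+ a = (a' \<^bold>+ b') \<^bold>* (a' \<^bold>+ b') \<^bold>+ a'"
  shows "c = \<^bold>0"
proof (rule ccontr)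
  assume "c \<noteq> \<^bold>0"
  then obtain d where d: "natural d" "c = d \<^bold>+ \<^bold>1" using natural_cases[OF nat(5)] by blast
  define r where "r = b \<^bold>+ (a \<^bold>+ b) \<^bold>* d \<^bold>+ (a \<^bold>+ b) \<^bold>* (d \<^bold>+ \<^bold>1) \<^bold>+ a'"
  define l where "l = (a \<^bold>+ b) \<^bold>* (a \<^bold>+ b) \<^bold>+ a"
  have r: "natural r" and l: "natural l"
    unfolding r_def l_def by (intro natural_add natural_mult natural_suc nat d)+
  have cc: "natural (c \<^bold>* c)" using natural_mult nat by blast
  have "l = l \<^bold>+ (c \<^bold>* c \<^bold>+ r)"
    using K.pairing_expand[of a b d a'] eq nat d unfolding sum d(2) r_def l_def by simp
  then have "c \<^bold>* c \<^bold>+ r = \<^bold>0" using K.add.l_cancel_one[of l "c \<^bold>* c \<^bold>+ r"] l r cc by simp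
  then have "c \<^bold>* c = \<^bold>0" using natural_add_eq_zero cc r by blast
  then show False using mult_neq_zero \<open>c \<noteq> \<^bold>0\<close> nat(5) by auto
qed

lemma pairing_inj:
  assumes nat: "natural a" "natural b" "natural a'" "natural b'"
    and eq: "(a \<^bold>+ b) \<^bold>* (a \<^bold>+ b) \<^bold>+ a = (a' \<^bold>+ b') \<^bold>* (a' \<^bold>+ b') \<^bold>+ a'"
  shows "a = a' \<and> b = b'"
proof -
  obtain c where c: "natural c" "a' \<^bold>+ b' = (a \<^bold>+ b) \<^bold>+ c \<or> a \<^bold>+ b = (a' \<^bold>+ b') \<^bold>+ c"
    using natural_total[of "a' \<^bold>+ b'" "a \<^bold>+ b"] natural_add nat by blast
  then have "c = \<^bold>0"
    using pairing_sum_eq[OF nat c(1) _ eq] pairing_sum_eq[OF nat(3,4,1,2) c(1) _ eq[symmetric]] by blast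
  then have s: "a \<^bold>+ b = a' \<^bold>+ b'" using c(2) nat by auto
  then have "a = a'" using eq nat by (simp add: add_left_cancel)
  then show ?thesis using s nat by (simp add: add_left_cancel)
qed

text \<open>
  The rational number \<open>s = m / d\<close> has the code \<open>(m + d)\<^sup>2 + m\<close>, where \<open>d\<close> is the least positive natural
  number for which \<open>s d\<close> is a natural number.  Minimality makes the code unique.  In \<open>\<omega>\<close> the order
  is membership, so the existence of a least denominator is the axiom of foundation.
\<close>
definition code :: "'m \<Rightarrow> 'm \<Rightarrow> bool" where
  "code s k \<longleftrightarrow> k \<^bold>\<in> \<omega> \<and> s \<^bold>\<in> Q \<and> (\<exists>d m. d \<^bold>\<in> \<omega> \<and> d \<noteq> \<emptyset> \<and> m \<^bold>\<in> \<omega> \<and> dmul s (dapp i d) = dapp i m \<and>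
     (\<forall>l. l \<^bold>\<in> d \<longrightarrow> l \<noteq> \<emptyset> \<longrightarrow> \<not> natural (dmul s (dapp i l))) \<and>
     dapp i k = dadd (dmul (dadd (dapp i m) (dapp i d)) (dadd (dapp i m) (dapp i d))) (dapp i m))"

lemma dfn_code: "dterm t \<Longrightarrow> dterm s \<Longrightarrow> dfn (\<lambda>e. code (t e) (s e))"
  by (rule dfn_subst2[where R = code]) (unfold code_def, intro q_dfn_intros)

lemma codeE:
  assumes "code s k"
  obtains d m where "k \<^bold>\<in> \<omega>" "s \<^bold>\<in> Q" "d \<^bold>\<in> \<omega>" "d \<noteq> \<emptyset>" "m \<^bold>\<in> \<omega>" "s \<^bold>* i \<cdot> d = i \<cdot> m"
    "\<And>l. l \<^bold>\<in> d \<Longrightarrow> l \<noteq> \<emptyset> \<Longrightarrow> \<not> natural (s \<^bold>* i \<cdot> l)"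
    "i \<cdot> k = (i \<cdot> m \<^bold>+ i \<cdot> d) \<^bold>* (i \<cdot> m \<^bold>+ i \<cdot> d) \<^bold>+ i \<cdot> m"
proof -
  obtain d m where *: "k \<^bold>\<in> \<omega>" "s \<^bold>\<in> Q" "d \<^bold>\<in> \<omega>" "d \<noteq> \<emptyset>" "m \<^bold>\<in> \<omega>" "dmul s (dapp i d) = dapp i m"
     "\<forall>l. l \<^bold>\<in> d \<longrightarrow> l \<noteq> \<emptyset> \<longrightarrow> \<not> natural (dmul s (dapp i l))"
     "dapp i k = dadd (dmul (dadd (dapp i m) (dapp i d)) (dadd (dapp i m) (dapp i d))) (dapp i m)"
    using assms unfolding code_def by blast
  show thesis
    using * mem_omega[OF *(3)] by (intro that[of d m]) simp_all
qed

lemma code_exists: assumes "nonneg s" shows "\<exists>k. code s k"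
proof -
  have s: "s \<^bold>\<in> Q" using assms unfolding nonneg_iff by blast
  have "dfn (\<lambda>e. e 0 \<noteq> \<emptyset> \<and> natural (dmul s (dapp i (e 0))))" by (intro q_dfn_intros)
  from separation_dfn[where P = "\<lambda>d. d \<noteq> \<emptyset> \<and> natural (dmul s (dapp i d))", OF this, of \<omega>]
  obtain D where D: "\<forall>d. d \<^bold>\<in> D \<longleftrightarrow> d \<^bold>\<in> \<omega> \<and> d \<noteq> \<emptyset> \<and> natural (dmul s (dapp i d))" by blast
  obtain d0 where d0: "natural d0" "d0 \<noteq> \<^bold>0" "natural (s \<^bold>* d0)" using assms unfolding nonneg_iff by blast
  obtain n where n: "n \<^bold>\<in> \<omega>" "d0 = i \<cdot> n" using d0(1) unfolding natural_iff by blast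
  have "n \<noteq> \<emptyset>" using d0(2) n(2) by auto
  moreover have "natural (dmul s (dapp i n))" using d0(3) n s by simp
  ultimately have "n \<^bold>\<in> D" using D n(1) by blast
  then obtain d where d: "d \<^bold>\<in> D" "\<not> (\<exists>l. l \<^bold>\<in> d \<and> l \<^bold>\<in> D)" using foundation[of D] by blast
  have d\<omega>: "d \<^bold>\<in> \<omega>" "d \<noteq> \<emptyset>" "natural (dmul s (dapp i d))" using D d by auto
  obtain m where m: "m \<^bold>\<in> \<omega>" "dmul s (dapp i d) = i \<cdot> m" using d\<omega>(3) unfolding natural_iff by blast
  have "natural ((i \<cdot> m \<^bold>+ i \<cdot> d) \<^bold>* (i \<cdot> m \<^bold>+ i \<cdot> d) \<^bold>+ i \<cdot> m)"
    by (intro natural_add natural_mult natural_i m d\<omega>)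
  then obtain k where k: "k \<^bold>\<in> \<omega>" "(i \<cdot> m \<^bold>+ i \<cdot> d) \<^bold>* (i \<cdot> m \<^bold>+ i \<cdot> d) \<^bold>+ i \<cdot> m = i \<cdot> k"
    unfolding natural_iff by blast
  have "\<forall>l. l \<^bold>\<in> d \<longrightarrow> l \<noteq> \<emptyset> \<longrightarrow> \<not> natural (dmul s (dapp i l))"
    using D d(2) mem_omega[OF d\<omega>(1)] by blast
  then have "code s k"
    unfolding code_def using k m d\<omega> s by (intro conjI exI[of _ d] exI[of _ m]) simp_all
  then show ?thesis by blast
qed

lemma code_functional: assumes 1: "code s k" and 2: "code s k'" shows "k = k'"
proof -
  obtain d m where d: "k \<^bold>\<in> \<omega>" "s \<^bold>\<in> Q" "d \<^bold>\<in> \<omega>" "d \<noteq> \<emptyset>" "m \<^bold>\<in> \<omega>" "s \<^bold>* i \<cdot> d = i \<cdot> m"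
    "\<And>l. l \<^bold>\<in> d \<Longrightarrow> l \<noteq> \<emptyset> \<Longrightarrow> \<not> natural (s \<^bold>* i \<cdot> l)"
    "i \<cdot> k = (i \<cdot> m \<^bold>+ i \<cdot> d) \<^bold>* (i \<cdot> m \<^bold>+ i \<cdot> d) \<^bold>+ i \<cdot> m"
    by (rule codeE[OF 1]) (rule that)
  obtain d' m' where d': "k' \<^bold>\<in> \<omega>" "s \<^bold>\<in> Q" "d' \<^bold>\<in> \<omega>" "d' \<noteq> \<emptyset>" "m' \<^bold>\<in> \<omega>" "s \<^bold>* i \<cdot> d' = i \<cdot> m'"
    "\<And>l. l \<^bold>\<in> d' \<Longrightarrow> l \<noteq> \<emptyset> \<Longrightarrow> \<not> natural (s \<^bold>* i \<cdot> l)"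
    "i \<cdot> k' = (i \<cdot> m' \<^bold>+ i \<cdot> d') \<^bold>* (i \<cdot> m' \<^bold>+ i \<cdot> d') \<^bold>+ i \<cdot> m'"
    by (rule codeE[OF 2]) (rule that)
  have "\<not> d \<^bold>\<in> d'" using d'(7)[of d] d(4-6) by auto
  moreover have "\<not> d' \<^bold>\<in> d" using d(7)[of d'] d'(4-6) by auto
  ultimately have "d = d'" using omega_trichotomy d(3) d'(3) by blast
  then show ?thesis using i_inj d(1,6,8) d'(1,6,8) by simp
qed

lemma code_inj: assumes 1: "code s k" and 2: "code t k" shows "s = t"
proof -
  obtain d m where d: "k \<^bold>\<in> \<omega>" "s \<^bold>\<in> Q" "d \<^bold>\<in> \<omega>" "d \<noteq> \<emptyset>" "m \<^bold>\<in> \<omega>" "s \<^bold>* i \<cdot> d = i \<cdot> m"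
    "i \<cdot> k = (i \<cdot> m \<^bold>+ i \<cdot> d) \<^bold>* (i \<cdot> m \<^bold>+ i \<cdot> d) \<^bold>+ i \<cdot> m"
    by (rule codeE[OF 1]) (rule that)
  obtain d' m' where d': "k \<^bold>\<in> \<omega>" "t \<^bold>\<in> Q" "d' \<^bold>\<in> \<omega>" "d' \<noteq> \<emptyset>" "m' \<^bold>\<in> \<omega>" "t \<^bold>* i \<cdot> d' = i \<cdot> m'"
    "i \<cdot> k = (i \<cdot> m' \<^bold>+ i \<cdot> d') \<^bold>* (i \<cdot> m' \<^bold>+ i \<cdot> d') \<^bold>+ i \<cdot> m'"
    by (rule codeE[OF 2]) (rule that)
  have "i \<cdot> m = i \<cdot> m' \<and> i \<cdot> d = i \<cdot> d'"
    by (rule pairing_inj) (use d d' in auto)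
  then have "s \<^bold>* i \<cdot> d = t \<^bold>* i \<cdot> d" using d d' by simp
  moreover have "i \<cdot> d \<noteq> \<^bold>0" using i_inj[of d \<emptyset>] d by auto
  ultimately show ?thesis using K.m_rcancel[of "i \<cdot> d" s t] d d' by simp
qed

end

section \<open>The colouring by the sum of squares of the coordinates\<close>

text \<open>
  How two sums change together when each has a term replaced (\<open>a\<close> by \<open>a'\<close> and \<open>b\<close> by \<open>b'\<close>).
\<close>
lemma (in abelian_group) add_diff_add_diff:
  assumes "x \<in> carrier G" "y \<in> carrier G" "a \<in> carrier G" "b \<in> carrier G" "a' \<in> carrier G" "b' \<in> carrier G"
  shows "(x \<oplus> (a' \<ominus> a)) \<oplus> (y \<oplus> (b' \<ominus> b)) = (x \<oplus> y) \<oplus> ((a' \<oplus> b') \<ominus> (a \<oplus> b))"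
  using assms by (simp add: minus_eq minus_add a_ac)

text \<open>
  With \<open>a = d + c\<close>, this is \<open>(2a)\<^sup>2 + (2c)\<^sup>2 = 2 ((a + c)\<^sup>2 + (a - c)\<^sup>2)\<close>.
\<close>
lemma (in cring) parallelogram:
  assumes "d \<in> carrier R" "c \<in> carrier R"
  shows "((d \<oplus> c) \<oplus> (d \<oplus> c)) \<otimes> ((d \<oplus> c) \<oplus> (d \<oplus> c)) \<oplus> (c \<oplus> c) \<otimes> (c \<oplus> c) =
    (((d \<oplus> c) \<oplus> c) \<otimes> ((d \<oplus> c) \<oplus> c) \<oplus> d \<otimes> d) \<oplus> (((d \<oplus> c) \<oplus> c) \<otimes> ((d \<oplus> c) \<oplus> c) \<oplus> d \<otimes> d)"
  using assms by (simp add: l_distr r_distr a_ac m_ac)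

lemma (in rational_field) square_map_exists:
  obtains sq where "sq : Q \<times>\<^sub>m W \<leadsto> Q"
    "\<And>q x. q \<^bold>\<in> Q \<Longrightarrow> x \<^bold>\<in> W \<Longrightarrow> sq \<cdot> \<langle>q, x\<rangle> = q \<^bold>* q"
proof -
  define t where "t u = (THE y. \<exists>q x. u = \<langle>q, x\<rangle> \<and> y = q \<^bold>* q)" for u
  have t: "t \<langle>q, x\<rangle> = q \<^bold>* q" for q x unfolding t_def by simp
  obtain sq where sq: "sq : Q \<times>\<^sub>m W \<leadsto> Q" "\<And>u. u \<^bold>\<in> Q \<times>\<^sub>m W \<Longrightarrow> sq \<cdot> u = t u"
  proof (rule func_exists[of "\<lambda>u y. \<exists>q x. u = \<langle>q, x\<rangle> \<and> y = dmul q q" "Q \<times>\<^sub>m W" t Q])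
    show "dfn (\<lambda>e. \<exists>q x. e 0 = \<langle>q, x\<rangle> \<and> e 1 = dmul q q)" by (intro q_dfn_intros)
  qed (auto simp: mem_cross t intro: that)
  show thesis
    by (rule that[OF sq(1)]) (simp add: sq(2) t)
qed

text \<open>
  A rational vector space with a basis \<open>B\<close>, together with the map \<open>sq\<close>, \<open>(q, x) \<mapsto> q\<^sup>2\<close>.  The sublocale \<open>vs\<close>
  is summation of the multiples \<open>f b \<cdot> b\<close> in the vector space, and \<open>nm\<close> is summation of the squares
  \<open>(f b)\<^sup>2\<close> in the field.
\<close>
locale rational_space = rational_field mem Q ad mu zeroQ oneQ i
  for mem :: "'m \<Rightarrow> 'm \<Rightarrow> bool"  (infix "\<^bold>\<in>" 50) and Q ad mu zeroQ oneQ i +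
  fixes V plusV scaleV zeroV B sq :: 'm
  assumes plusV: "func mem plusV (cross mem V V) V"
    and scaleV: "func mem scaleV (cross mem Q V) V"
    and module: "module K (module_of mem V plusV scaleV zeroV)"
    and basis: "basis mem Q K V (module_of mem V plusV scaleV zeroV) B"
    and sq: "func mem sq (cross mem Q V) Q"
    and sq_app: "q \<^bold>\<in> Q \<Longrightarrow> x \<^bold>\<in> V \<Longrightarrow> app mem sq (pair mem q x) = q \<^bold>* q"
begin

lemma B_V: "b \<^bold>\<in> B \<Longrightarrow> b \<^bold>\<in> V"
  using basis unfolding basis_def by blast

sublocale vs: finite_sums mem Q K V plusV scaleV zeroV V B
proof (intro finite_sums.intro finite_sums_axioms.intro ZF_model_axioms)
  show "\<^bold>0 \<^bold>\<in> Q" by simp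
  show "abelian_group (module_of mem V plusV scaleV zeroV)"
    using module by (rule module.axioms)
  show "scaleV \<cdot> \<langle>\<^bold>0, b\<rangle> = zeroV" if "b \<^bold>\<in> B" for b
    using module.smult_l_null[OF module, of b] B_V[OF that] by (simp add: module_of_def elems_def)
qed (fact plusV scaleV B_V)+

sublocale nm: finite_sums mem Q K Q ad sq zeroQ V B
proof (intro finite_sums.intro finite_sums_axioms.intro ZF_model_axioms)
  have M: "x \<in> carrier (module_of mem Q ad sq zeroQ) \<longleftrightarrow> x \<^bold>\<in> Q" "\<zero>\<^bsub>module_of mem Q ad sq zeroQ\<^esub> = \<^bold>0"
    "x \<oplus>\<^bsub>module_of mem Q ad sq zeroQ\<^esub> y = x \<^bold>+ y" for x y
    by (simp_all add: module_of_def elems_def K_ops)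
  show "abelian_group (module_of mem Q ad sq zeroQ)"
  proof (rule abelian_groupI; (unfold M)?)
    show "\<exists>y\<in>carrier (module_of mem Q ad sq zeroQ). y \<^bold>+ x = \<^bold>0" if "x \<^bold>\<in> Q" for x
      using that K.l_neg[of x] K.a_inv_closed[of x] by (intro bexI[of _ "\<ominus>\<^bsub>K\<^esub> x"]) (simp_all add: M)
  qed (use K.a_assoc K.a_comm K.l_zero in simp_all)
  show "sq \<cdot> \<langle>\<^bold>0, b\<rangle> = zeroQ" if "b \<^bold>\<in> B" for b
  proof -
    have "sq \<cdot> \<langle>\<^bold>0, b\<rangle> = \<^bold>0" using sq_app[of "\<^bold>0" b] B_V[OF that] by simp
    then show ?thesis using K_ops(3) by (rule trans)
  qed
qed (fact ad sq B_V vs.zero_k)+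

abbreviation (input) plus_V (infixl "\<boxplus>" 65) where "x \<boxplus> y \<equiv> plusV \<cdot> \<langle>x, y\<rangle>"

definition dplus where "dplus x y = dapp plusV \<langle>x, y\<rangle>"

lemma dplus [simp]: "x \<^bold>\<in> V \<Longrightarrow> y \<^bold>\<in> V \<Longrightarrow> dplus x y = x \<boxplus> y"
  unfolding dplus_def by (rule func_dapp[OF plusV]) simp

lemma dterm_dplus: "dterm t \<Longrightarrow> dterm s \<Longrightarrow> dterm (\<lambda>e. dplus (t e) (s e))"
  unfolding dplus_def by (intro zf_dfn_intros)

lemmas vs_dfn_intros = q_dfn_intros dfn_nonneg dfn_code dterm_dplus vs.dfn_dlin nm.dfn_dlin

abbreviation coeffs where "coeffs f \<equiv> f : B \<leadsto> Q"

lemma coeff_closed [simp]: "coeffs f \<Longrightarrow> b \<^bold>\<in> B \<Longrightarrow> f \<cdot> b \<^bold>\<in> Q"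
  by (rule func_app)

lemma coeff_dapp: "coeffs f \<Longrightarrow> b \<^bold>\<in> B \<Longrightarrow> dapp f b = f \<cdot> b"
  by (rule func_dapp)

text \<open>
  A relation, since pointwise sums are functions of the model and exist only by \<open>func_exists\<close>.
  Differences are expressed by it too: \<open>is_sum f d g\<close> says that \<open>d = f - g\<close>.
\<close>
definition is_sum where
  "is_sum h f g \<longleftrightarrow> coeffs h \<and> coeffs f \<and> coeffs g \<and> (\<forall>b. b \<^bold>\<in> B \<longrightarrow> dapp h b = dadd (dapp f b) (dapp g b))"

lemma dfn_is_sum: "dterm t \<Longrightarrow> dterm s \<Longrightarrow> dterm r \<Longrightarrow> dfn (\<lambda>e. is_sum (t e) (s e) (r e))"
  by (rule dfn_subst3[where R = is_sum]) (unfold is_sum_def, intro q_dfn_intros)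

lemma is_sum_iff: "is_sum h f g \<longleftrightarrow> coeffs h \<and> coeffs f \<and> coeffs g \<and> (\<forall>b. b \<^bold>\<in> B \<longrightarrow> h \<cdot> b = f \<cdot> b \<^bold>+ g \<cdot> b)"
  unfolding is_sum_def by (auto simp: coeff_dapp)

lemma sum_exists: assumes "coeffs f" "coeffs g" shows "\<exists>h. is_sum h f g"
proof -
  obtain h where "coeffs h" "\<And>b. b \<^bold>\<in> B \<Longrightarrow> h \<cdot> b = f \<cdot> b \<^bold>+ g \<cdot> b"
  proof (rule func_exists[of "\<lambda>b y. y = dadd (dapp f b) (dapp g b)" B "\<lambda>b. f \<cdot> b \<^bold>+ g \<cdot> b" Q])
    show "dfn (\<lambda>e. e 1 = dadd (dapp f (e 0)) (dapp g (e 0)))" by (intro q_dfn_intros)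
  qed (use assms in \<open>auto simp: coeff_dapp intro: that\<close>)
  then show ?thesis unfolding is_sum_iff using assms by blast
qed

lemma difference_exists: assumes f: "coeffs f" and g: "coeffs g" shows "\<exists>d. is_sum f d g"
proof -
  have eq: "(x = y \<^bold>+ z) = (y = x \<ominus>\<^bsub>K\<^esub> z)" if "x \<^bold>\<in> Q" "y \<^bold>\<in> Q" "z \<^bold>\<in> Q" for x y z
    using that K.minus_eq[of x z] K.a_assoc[of y z "\<ominus>\<^bsub>K\<^esub> z"] K.a_assoc[of x "\<ominus>\<^bsub>K\<^esub> z" z]
      K.r_neg[of z] K.l_neg[of z] K.a_inv_closed[of z] by auto
  obtain d where d: "coeffs d" "\<And>b. b \<^bold>\<in> B \<Longrightarrow> d \<cdot> b = f \<cdot> b \<ominus>\<^bsub>K\<^esub> g \<cdot> b"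
  proof (rule func_exists[of "\<lambda>b y. dapp f b = dadd y (dapp g b)" B "\<lambda>b. f \<cdot> b \<ominus>\<^bsub>K\<^esub> g \<cdot> b" Q])
    show "dfn (\<lambda>e. dapp f (e 0) = dadd (e 1) (dapp g (e 0)))" by (intro q_dfn_intros)
  next
    show "f \<cdot> b \<ominus>\<^bsub>K\<^esub> g \<cdot> b \<^bold>\<in> Q" if "b \<^bold>\<in> B" for b
      using K.minus_closed[of "f \<cdot> b" "g \<cdot> b"] that f g by simp
  qed (use f g in \<open>auto simp: coeff_dapp eq intro: that\<close>)
  have "f \<cdot> b = d \<cdot> b \<^bold>+ g \<cdot> b" if "b \<^bold>\<in> B" for b
  proof -
    have "f \<cdot> b \<^bold>\<in> Q" "d \<cdot> b \<^bold>\<in> Q" "g \<cdot> b \<^bold>\<in> Q" using d(1) f g that by (simp_all only: coeff_closed)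
    from iffD2[OF eq[OF this] d(2)[OF that]] show ?thesis .
  qed
  then show ?thesis unfolding is_sum_iff using d f g by blast
qed

lemma sum_at:
  assumes ff': "\<And>c. c \<^bold>\<in> B \<Longrightarrow> c \<noteq> b \<Longrightarrow> f' \<cdot> c = f \<cdot> c"
    and gg': "\<And>c. c \<^bold>\<in> B \<Longrightarrow> c \<noteq> b \<Longrightarrow> g' \<cdot> c = g \<cdot> c"
    and h: "is_sum h f g" "is_sum h' f' g'"
    and c: "c \<^bold>\<in> B" "c \<noteq> b"
  shows "h' \<cdot> c = h \<cdot> c"
  using h c ff' gg' unfolding is_sum_iff by simp

lemma difference_at:
  assumes ff': "\<And>c. c \<^bold>\<in> B \<Longrightarrow> c \<noteq> b \<Longrightarrow> f' \<cdot> c = f \<cdot> c"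
    and gg': "\<And>c. c \<^bold>\<in> B \<Longrightarrow> c \<noteq> b \<Longrightarrow> g' \<cdot> c = g \<cdot> c"
    and h: "is_sum f h g" "is_sum f' h' g'"
    and c: "c \<^bold>\<in> B" "c \<noteq> b"
  shows "h' \<cdot> c = h \<cdot> c"
proof -
  have "h \<cdot> c \<^bold>+ g \<cdot> c = h' \<cdot> c \<^bold>+ g \<cdot> c" using h c ff' gg' unfolding is_sum_iff by metis
  then show ?thesis using h c K.add.right_cancel[of "g \<cdot> c" "h \<cdot> c" "h' \<cdot> c"] unfolding is_sum_iff by simp
qed

text \<open>
  The induction proves that the sum of the squares of \<open>d\<close> exists, which is equivalent to finite
  support, and which a change of \<open>d\<close> at one place preserves.
\<close>
lemma fin_supp_difference:
  assumes f: "coeffs f" "fin_supp B \<^bold>0 f" and g: "coeffs g" "fin_supp B \<^bold>0 g" and d: "is_sum f d g"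
  shows "fin_supp B \<^bold>0 d"
proof -
  define P where "P f g \<longleftrightarrow> (\<forall>d. is_sum f d g \<longrightarrow> (\<exists>s. nm.dlin d s))" for f g
  have "P f g"
  proof (rule support_induct2[where P = P, OF _ f g vs.zero_k])
    show "dfn (\<lambda>e. P (e 0) (e 1))" unfolding P_def by (intro vs_dfn_intros dfn_is_sum)
  next
    fix f g assume fg: "coeffs f" "coeffs g" "\<And>b. b \<^bold>\<in> B \<Longrightarrow> f \<cdot> b = \<^bold>0" "\<And>b. b \<^bold>\<in> B \<Longrightarrow> g \<cdot> b = \<^bold>0"
    show "P f g" unfolding P_def
    proof (intro allI impI)
      fix d assume "is_sum f d g"
      then have d: "coeffs d" and eq: "\<And>b. b \<^bold>\<in> B \<Longrightarrow> f \<cdot> b = d \<cdot> b \<^bold>+ g \<cdot> b" unfolding is_sum_iff by blast+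
      have d: "coeffs d" "\<And>b. b \<^bold>\<in> B \<Longrightarrow> d \<cdot> b = \<^bold>0" using d eq fg(3,4) by simp_all
      then show "\<exists>s. nm.dlin d s" using nm.lin_zero[OF d] by (simp add: nm.dlin_iff)
    qed
  next
    fix f g f' g' b assume fg: "coeffs f" "coeffs g" "coeffs f'" "coeffs g'" "b \<^bold>\<in> B"
       "\<And>c. c \<^bold>\<in> B \<Longrightarrow> c \<noteq> b \<Longrightarrow> f' \<cdot> c = f \<cdot> c"
       "\<And>c. c \<^bold>\<in> B \<Longrightarrow> c \<noteq> b \<Longrightarrow> g' \<cdot> c = g \<cdot> c" and IH: "P f g"
    show "P f' g'" unfolding P_def
    proof (intro allI impI)
      fix d' assume d': "is_sum f' d' g'"
      obtain d where d: "is_sum f d g" using difference_exists fg(1,2) by blast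
      then obtain s where "nm.lin d s" using IH unfolding P_def nm.dlin_iff by blast
      moreover have "coeffs d" "coeffs d'" using d d' unfolding is_sum_iff by auto
      ultimately show "\<exists>s. nm.dlin d' s"
        unfolding nm.dlin_iff
        using nm.lin_update[OF _ _ fg(5) difference_at[where b = b, OF fg(6,7) d d']] by blast
    qed
  qed
  then show ?thesis using d nm.lin_fin_supp unfolding P_def nm.dlin_iff by blast
qed

text \<open>
  A change of \<open>f\<close> and \<open>g\<close> at \<open>b\<close> alters the sums of \<open>f\<close>, \<open>g\<close> and \<open>f + g\<close> by the differences of terms at
  \<open>b\<close>, and \<open>q \<mapsto> q \<cdot> b\<close> is additive.
\<close>
lemma vs_sum:
  assumes f: "vs.lin f x" and g: "vs.lin g y" and h: "is_sum h f g"
  shows "vs.lin h (x \<boxplus> y)"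
proof -
  interpret M: module K vs.M by (rule module)
  have cf: "coeffs f" and cg: "coeffs g" using h unfolding is_sum_iff by auto
  define P where "P f g \<longleftrightarrow> (\<forall>h. is_sum h f g \<longrightarrow>
      (\<exists>x y. vs.dlin f x \<and> vs.dlin g y \<and> vs.dlin h (dplus x y)))" for f g
  have "P f g"
  proof (rule support_induct2[where P = P, OF _ cf vs.lin_fin_supp[OF f] cg vs.lin_fin_supp[OF g] vs.zero_k])
    show "dfn (\<lambda>e. P (e 0) (e 1))" unfolding P_def by (intro vs_dfn_intros dfn_is_sum)
  next
    fix f g assume fg: "coeffs f" "coeffs g" "\<And>b. b \<^bold>\<in> B \<Longrightarrow> f \<cdot> b = \<^bold>0" "\<And>b. b \<^bold>\<in> B \<Longrightarrow> g \<cdot> b = \<^bold>0"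
    show "P f g" unfolding P_def
    proof (intro allI impI)
      fix h assume "is_sum h f g"
      then have h: "coeffs h" "\<And>b. b \<^bold>\<in> B \<Longrightarrow> h \<cdot> b = \<^bold>0" using fg unfolding is_sum_iff by simp_all
      have "zeroV \<boxplus> zeroV = zeroV" using M.l_zero[of zeroV] vs.z_closed by simp
      then show "\<exists>x y. vs.dlin f x \<and> vs.dlin g y \<and> vs.dlin h (dplus x y)"
        using vs.lin_zero[OF h] vs.lin_zero[OF fg(1,3)] vs.lin_zero[OF fg(2,4)] fg h vs.z_closed
        by (simp add: vs.dlin_iff)
    qed
  next
    fix f g f' g' b assume fg: "coeffs f" "coeffs g" "coeffs f'" "coeffs g'" "b \<^bold>\<in> B"
       "\<And>c. c \<^bold>\<in> B \<Longrightarrow> c \<noteq> b \<Longrightarrow> f' \<cdot> c = f \<cdot> c"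
       "\<And>c. c \<^bold>\<in> B \<Longrightarrow> c \<noteq> b \<Longrightarrow> g' \<cdot> c = g \<cdot> c" and IH: "P f g"
    have b: "b \<in> carrier vs.M" using B_V fg(5) by simp
    show "P f' g'" unfolding P_def
    proof (intro allI impI)
      fix h' assume h': "is_sum h' f' g'"
      obtain h where h: "is_sum h f g" using sum_exists fg(1,2) by blast
      have ch: "coeffs h" "coeffs h'" using h h' unfolding is_sum_iff by auto
      obtain x y where x: "vs.lin f x" and y: "vs.lin g y" and d: "vs.dlin h (dplus x y)"
        using IH h unfolding P_def vs.dlin_iff by blast
      have xy: "x \<in> carrier vs.M" "y \<in> carrier vs.M" using vs.lin_closed x y by auto
      then have hxy: "vs.lin h (x \<oplus>\<^bsub>vs.M\<^esub> y)" using d by (simp add: vs.dlin_iff)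
      define s where "s f = f \<cdot> b \<odot>\<^bsub>vs.M\<^esub> b" for f
      have sc: "s f \<in> carrier vs.M" if "coeffs f" for f
        unfolding s_def using that b fg(5) by (intro M.smult_closed) simp_all
      have sh: "s h = s f \<oplus>\<^bsub>vs.M\<^esub> s g" "s h' = s f' \<oplus>\<^bsub>vs.M\<^esub> s g'"
        unfolding s_def using h h' fg(5) b unfolding is_sum_iff
        by (auto simp del: vs.M_simps(3,4) intro!: M.smult_l_distr)
      have "vs.lin f' (x \<oplus>\<^bsub>vs.M\<^esub> (s f' \<ominus>\<^bsub>vs.M\<^esub> s f))"
        unfolding s_def by (rule vs.lin_update[OF fg(1,3,5,6) x])
      moreover have "vs.lin g' (y \<oplus>\<^bsub>vs.M\<^esub> (s g' \<ominus>\<^bsub>vs.M\<^esub> s g))"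
        unfolding s_def by (rule vs.lin_update[OF fg(2,4,5,7) y])
      moreover have "vs.lin h' ((x \<oplus>\<^bsub>vs.M\<^esub> y) \<oplus>\<^bsub>vs.M\<^esub> (s h' \<ominus>\<^bsub>vs.M\<^esub> s h))"
        unfolding s_def by (rule vs.lin_update[OF ch fg(5) sum_at[where b = b, OF fg(6,7) h h'] hxy])
      then have "vs.lin h' ((x \<oplus>\<^bsub>vs.M\<^esub> (s f' \<ominus>\<^bsub>vs.M\<^esub> s f)) \<oplus>\<^bsub>vs.M\<^esub> (y \<oplus>\<^bsub>vs.M\<^esub> (s g' \<ominus>\<^bsub>vs.M\<^esub> s g)))"
        unfolding sh M.add_diff_add_diff[OF xy sc[OF fg(1)] sc[OF fg(2)] sc[OF fg(3)] sc[OF fg(4)]] .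
      ultimately show "\<exists>x y. vs.dlin f' x \<and> vs.dlin g' y \<and> vs.dlin h' (dplus x y)"
        unfolding vs.dlin_iff using fg(3,4) ch(2) vs.lin_closed dplus vs.M_simps(4) by metis
    qed
  qed
  then obtain x' y' where "vs.dlin f x'" "vs.dlin g y'" "vs.dlin h (dplus x' y')"
    unfolding P_def using h by blast
  moreover from this have "x' = x" "y' = y"
    using vs.lin_unique[OF cf _ f] vs.lin_unique[OF cg _ g] unfolding vs.dlin_iff by auto
  ultimately show ?thesis using vs.lin_closed[OF f] vs.lin_closed[OF g] by (simp add: vs.dlin_iff)
qed

lemma nm_update:
  assumes f: "coeffs f" and g: "coeffs g" and b: "b \<^bold>\<in> B"
    and fg: "\<And>c. c \<^bold>\<in> B \<Longrightarrow> c \<noteq> b \<Longrightarrow> g \<cdot> c = f \<cdot> c" and fx: "nm.lin f x"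
  shows "nm.lin g (x \<^bold>+ (g \<cdot> b \<^bold>* g \<cdot> b \<ominus>\<^bsub>K\<^esub> f \<cdot> b \<^bold>* f \<cdot> b))"
proof -
  have "\<ominus>\<^bsub>nm.M\<^esub> y = \<ominus>\<^bsub>K\<^esub> y" if "y \<^bold>\<in> Q" for y
    using abelian_group.minus_equality[OF nm.group, of "\<ominus>\<^bsub>K\<^esub> y" y] that
      K.l_neg[of y] K.a_inv_closed[of y] by (simp add: K_ops)
  then have "x \<ominus>\<^bsub>nm.M\<^esub> y = x \<ominus>\<^bsub>K\<^esub> y" if "y \<^bold>\<in> Q" for x y
    using that by (simp add: a_minus_def K_ops)
  then show ?thesis
    using nm.lin_update[OF f g b fg fx] sq_app f g b B_V by (simp add: K_ops(1))
qed

text \<open>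
  The parallelogram law for single rational numbers holds at \<open>b\<close> before and after the change, so
  the changes of the four sums of squares satisfy it as well.
\<close>
lemma nm_parallelogram:
  assumes f: "coeffs f" "fin_supp B \<^bold>0 f" and g: "coeffs g" "fin_supp B \<^bold>0 g"
    and u: "is_sum u f f" and v: "is_sum v g g" and m: "is_sum m f g" and d: "is_sum f d g"
  obtains su sv sm sd where "nm.lin u su" "nm.lin v sv" "nm.lin m sm" "nm.lin d sd"
    "su \<^bold>+ sv = (sm \<^bold>+ sd) \<^bold>+ (sm \<^bold>+ sd)"
proof -
  define P where "P f g \<longleftrightarrow> (\<forall>u v m d. is_sum u f f \<longrightarrow> is_sum v g g \<longrightarrow> is_sum m f g \<longrightarrow> is_sum f d g \<longrightarrow>
      (\<exists>su sv sm sd. nm.dlin u su \<and> nm.dlin v sv \<and> nm.dlin m sm \<and> nm.dlin d sd \<and>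
        dadd su sv = dadd (dadd sm sd) (dadd sm sd)))" for f g
  have "P f g"
  proof (rule support_induct2[where P = P, OF _ f g vs.zero_k])
    show "dfn (\<lambda>e. P (e 0) (e 1))" unfolding P_def by (intro vs_dfn_intros dfn_is_sum)
  next
    fix f g assume fg: "coeffs f" "coeffs g" "\<And>b. b \<^bold>\<in> B \<Longrightarrow> f \<cdot> b = \<^bold>0" "\<And>b. b \<^bold>\<in> B \<Longrightarrow> g \<cdot> b = \<^bold>0"
    have nz: "nm.dlin h \<^bold>0" if "coeffs h" "\<And>b. b \<^bold>\<in> B \<Longrightarrow> h \<cdot> b = \<^bold>0" for h
      using nm.lin_zero[OF that] that by (simp add: nm.dlin_iff K_ops(3))
    show "P f g" unfolding P_def
    proof (intro allI impI exI conjI)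
      fix u v m d assume s: "is_sum u f f" "is_sum v g g" "is_sum m f g" "is_sum f d g"
      show "nm.dlin u \<^bold>0" "nm.dlin v \<^bold>0" "nm.dlin m \<^bold>0" "nm.dlin d \<^bold>0"
        using s fg unfolding is_sum_iff by (auto intro!: nz)
    qed simp
  next
    fix f g f' g' b assume fg: "coeffs f" "coeffs g" "coeffs f'" "coeffs g'" "b \<^bold>\<in> B"
       "\<And>c. c \<^bold>\<in> B \<Longrightarrow> c \<noteq> b \<Longrightarrow> f' \<cdot> c = f \<cdot> c"
       "\<And>c. c \<^bold>\<in> B \<Longrightarrow> c \<noteq> b \<Longrightarrow> g' \<cdot> c = g \<cdot> c" and IH: "P f g"
    show "P f' g'" unfolding P_def
    proof (intro allI impI)
      fix u' v' m' d'
      assume s': "is_sum u' f' f'" "is_sum v' g' g'" "is_sum m' f' g'" "is_sum f' d' g'"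
      obtain u v m d where s: "is_sum u f f" "is_sum v g g" "is_sum m f g" "is_sum f d g"
        using sum_exists difference_exists fg(1,2) by meson
      have co: "coeffs u" "coeffs v" "coeffs m" "coeffs d" "coeffs u'" "coeffs v'" "coeffs m'" "coeffs d'"
        using s s' unfolding is_sum_iff by auto
      obtain su sv sm sd where l: "nm.lin u su" "nm.lin v sv" "nm.lin m sm" "nm.lin d sd"
        and eq: "dadd su sv = dadd (dadd sm sd) (dadd sm sd)"
        using IH s unfolding P_def nm.dlin_iff by blast
      have S: "su \<^bold>\<in> Q" "sv \<^bold>\<in> Q" "sm \<^bold>\<in> Q" "sd \<^bold>\<in> Q" using nm.lin_closed l by auto
      have eq: "su \<^bold>+ sv = (sm \<^bold>+ sd) \<^bold>+ (sm \<^bold>+ sd)" using eq S by simp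
      define q where "q h = h \<cdot> b \<^bold>* h \<cdot> b" for h
      have q: "q h \<in> carrier K" if "coeffs h" for h unfolding q_def using that fg(5) by simp
      have par: "q u \<^bold>+ q v = (q m \<^bold>+ q d) \<^bold>+ (q m \<^bold>+ q d)"
        if "is_sum u f f" "is_sum v g g" "is_sum m f g" "is_sum f d g" for u v m d f g
        using that K.parallelogram[of "d \<cdot> b" "g \<cdot> b"] fg(5) unfolding is_sum_iff q_def by simp
      have "nm.lin u' (su \<^bold>+ (q u' \<ominus>\<^bsub>K\<^esub> q u))" unfolding q_def
        by (rule nm_update[OF co(1,5) fg(5) sum_at[where b = b, OF fg(6,6) s(1) s'(1)] l(1)])
      moreover have "nm.lin v' (sv \<^bold>+ (q v' \<ominus>\<^bsub>K\<^esub> q v))" unfolding q_def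
        by (rule nm_update[OF co(2,6) fg(5) sum_at[where b = b, OF fg(7,7) s(2) s'(2)] l(2)])
      moreover have "nm.lin m' (sm \<^bold>+ (q m' \<ominus>\<^bsub>K\<^esub> q m))" unfolding q_def
        by (rule nm_update[OF co(3,7) fg(5) sum_at[where b = b, OF fg(6,7) s(3) s'(3)] l(3)])
      moreover have "nm.lin d' (sd \<^bold>+ (q d' \<ominus>\<^bsub>K\<^esub> q d))" unfolding q_def
        by (rule nm_update[OF co(4,8) fg(5) difference_at[where b = b, OF fg(6,7) s(4) s'(4)] l(4)])
      moreover have "(su \<^bold>+ (q u' \<ominus>\<^bsub>K\<^esub> q u)) \<^bold>+ (sv \<^bold>+ (q v' \<ominus>\<^bsub>K\<^esub> q v)) =
        ((sm \<^bold>+ (q m' \<ominus>\<^bsub>K\<^esub> q m)) \<^bold>+ (sd \<^bold>+ (q d' \<ominus>\<^bsub>K\<^esub> q d))) \<^bold>+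
        ((sm \<^bold>+ (q m' \<ominus>\<^bsub>K\<^esub> q m)) \<^bold>+ (sd \<^bold>+ (q d' \<ominus>\<^bsub>K\<^esub> q d)))"
      proof -
        have "(su \<^bold>+ (q u' \<ominus>\<^bsub>K\<^esub> q u)) \<^bold>+ (sv \<^bold>+ (q v' \<ominus>\<^bsub>K\<^esub> q v)) =
          (su \<^bold>+ sv) \<^bold>+ ((q u' \<^bold>+ q v') \<ominus>\<^bsub>K\<^esub> (q u \<^bold>+ q v))"
          using S q co by (intro K.add_diff_add_diff) auto
        moreover have "(sm \<^bold>+ (q m' \<ominus>\<^bsub>K\<^esub> q m)) \<^bold>+ (sd \<^bold>+ (q d' \<ominus>\<^bsub>K\<^esub> q d)) =
          (sm \<^bold>+ sd) \<^bold>+ ((q m' \<^bold>+ q d') \<ominus>\<^bsub>K\<^esub> (q m \<^bold>+ q d))"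
          using S q co by (intro K.add_diff_add_diff) auto
        moreover have "((sm \<^bold>+ sd) \<^bold>+ ((q m' \<^bold>+ q d') \<ominus>\<^bsub>K\<^esub> (q m \<^bold>+ q d))) \<^bold>+
          ((sm \<^bold>+ sd) \<^bold>+ ((q m' \<^bold>+ q d') \<ominus>\<^bsub>K\<^esub> (q m \<^bold>+ q d))) = ((sm \<^bold>+ sd) \<^bold>+ (sm \<^bold>+ sd)) \<^bold>+
          (((q m' \<^bold>+ q d') \<^bold>+ (q m' \<^bold>+ q d')) \<ominus>\<^bsub>K\<^esub> ((q m \<^bold>+ q d) \<^bold>+ (q m \<^bold>+ q d)))"
          using S q co by (intro K.add_diff_add_diff) auto
        ultimately show ?thesis using par[OF s] par[OF s'] eq by simp
      qed
      ultimately show "\<exists>su sv sm sd. nm.dlin u' su \<and> nm.dlin v' sv \<and> nm.dlin m' sm \<and> nm.dlin d' sd \<and>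
        dadd su sv = dadd (dadd sm sd) (dadd sm sd)"
        unfolding nm.dlin_iff using co nm.lin_closed by (metis dadd Q_closed(3))
    qed
  qed
  then obtain su sv sm sd where l: "nm.lin u su" "nm.lin v sv" "nm.lin m sm" "nm.lin d sd"
    and eq: "dadd su sv = dadd (dadd sm sd) (dadd sm sd)"
    using u v m d unfolding P_def nm.dlin_iff by blast
  moreover have "su \<^bold>\<in> Q" "sv \<^bold>\<in> Q" "sm \<^bold>\<in> Q" "sd \<^bold>\<in> Q" using nm.lin_closed l by auto
  ultimately show thesis using that by simp
qed

text \<open>
  In each step a square is added to the sum, because the coefficient that changes was zero.
\<close>
lemma nm_nonneg: assumes f: "coeffs f" and s: "nm.lin f s" shows "nonneg s"
proof -
  have "\<forall>s. nm.dlin f s \<longrightarrow> nonneg s"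
  proof (rule support_induct[where P = "\<lambda>f. \<forall>s. nm.dlin f s \<longrightarrow> nonneg s",
        OF _ f nm.lin_fin_supp[OF s] vs.zero_k])
    show "dfn (\<lambda>e. \<forall>s. nm.dlin (e 0) s \<longrightarrow> nonneg s)" by (intro vs_dfn_intros)
  next
    show "\<forall>s. nm.dlin h s \<longrightarrow> nonneg s" if "coeffs h" "\<And>b. b \<^bold>\<in> B \<Longrightarrow> h \<cdot> b = \<^bold>0" for h
      using nm.lin_zero[OF that] nonneg_zero by (simp add: nm.dlin_iff K_ops(3))
  next
    fix g h b assume g: "coeffs g" and h: "coeffs h" and b: "b \<^bold>\<in> B" and gb: "g \<cdot> b = \<^bold>0"
      and gh: "\<And>c. c \<^bold>\<in> B \<Longrightarrow> c \<noteq> b \<Longrightarrow> h \<cdot> c = g \<cdot> c" and IH: "\<forall>s. nm.dlin g s \<longrightarrow> nonneg s"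
    show "\<forall>s. nm.dlin h s \<longrightarrow> nonneg s"
    proof (intro allI impI)
      fix s assume "nm.dlin h s"
      then have s: "nm.lin h s" by (simp add: nm.dlin_iff)
      then have sQ: "s \<^bold>\<in> Q" using nm.lin_closed by blast
      define r where "r = h \<cdot> b \<^bold>* h \<cdot> b"
      have r: "r \<^bold>\<in> Q" "nonneg r" unfolding r_def using h b nonneg_square by auto
      have "nm.lin g (s \<^bold>+ (\<^bold>0 \<ominus>\<^bsub>K\<^esub> r))"
        using nm_update[OF h g b _ s] gh gb unfolding r_def by simp
      then have "nonneg (s \<^bold>+ (\<^bold>0 \<ominus>\<^bsub>K\<^esub> r))" using IH g unfolding nm.dlin_iff by blast
      then have "nonneg ((s \<^bold>+ (\<^bold>0 \<ominus>\<^bsub>K\<^esub> r)) \<^bold>+ r)" using nonneg_add r by blast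
      moreover have "(s \<^bold>+ (\<^bold>0 \<ominus>\<^bsub>K\<^esub> r)) \<^bold>+ r = s"
        using sQ r K.a_inv_closed[of r] K.l_neg[of r] K.a_assoc[of s "\<ominus>\<^bsub>K\<^esub> r" r] K.l_zero[of "\<ominus>\<^bsub>K\<^esub> r"]
        by (simp add: K.minus_eq)
      ultimately show "nonneg s" by simp
    qed
  qed
  then show ?thesis using f s by (simp add: nm.dlin_iff)
qed

text \<open>
  If the sum of squares is zero, deleting the coefficient at \<open>b\<close> leaves the sum \<open>- (f b)\<^sup>2\<close>, which is
  nonnegative as a sum of squares; so \<open>(f b)\<^sup>2\<close> and its negative are both nonnegative.
\<close>
lemma nm_definite: assumes f: "coeffs f" and s: "nm.lin f \<^bold>0" and b: "b \<^bold>\<in> B" shows "f \<cdot> b = \<^bold>0"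
proof -
  obtain g where g: "coeffs g" and gc: "\<And>c. c \<^bold>\<in> B \<Longrightarrow> g \<cdot> c = (if c = b then \<^bold>0 else f \<cdot> c)"
    by (rule func_update[OF f vs.zero_k, of b]) (rule that)
  define r where "r = f \<cdot> b \<^bold>* f \<cdot> b"
  have r: "r \<^bold>\<in> Q" "nonneg r" unfolding r_def using f b nonneg_square by auto
  have "nm.lin g (\<^bold>0 \<^bold>+ (\<^bold>0 \<ominus>\<^bsub>K\<^esub> r))"
    using nm_update[OF f g b _ s] gc b unfolding r_def by simp
  then have "nonneg (\<^bold>0 \<^bold>+ (\<^bold>0 \<ominus>\<^bsub>K\<^esub> r))" using nm_nonneg[OF g] by blast
  moreover have "\<^bold>0 \<^bold>+ (\<^bold>0 \<ominus>\<^bsub>K\<^esub> r) = \<ominus>\<^bsub>K\<^esub> r"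
    using r K.a_inv_closed[of r] K.l_zero[of "\<ominus>\<^bsub>K\<^esub> r"] by (simp add: K.minus_eq)
  moreover have "r \<^bold>+ \<ominus>\<^bsub>K\<^esub> r = \<^bold>0" using r K.r_neg by simp
  ultimately have "r = \<^bold>0" using nonneg_add_eq_zero[of r "\<ominus>\<^bsub>K\<^esub> r"] r by simp
  then show ?thesis unfolding r_def using mult_neq_zero f b by (metis coeff_closed)
qed

text \<open>
  The difference of \<open>f\<close> and \<open>g\<close> has the sum zero, so it vanishes by linear independence.
\<close>
lemma coordinates_unique:
  assumes f: "coeffs f" "vs.lin f x" and g: "coeffs g" "vs.lin g x" shows "f = g"
proof (rule func_ext[OF f(1) g(1)])
  interpret M: module K vs.M by (rule module)
  fix b assume b: "b \<^bold>\<in> B"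
  obtain d where d: "is_sum f d g" using difference_exists f g by blast
  then have cd: "coeffs d" unfolding is_sum_iff by blast
  have "fin_supp B \<^bold>0 d" using fin_supp_difference f g d vs.lin_fin_supp by blast
  then obtain w where w: "vs.lin d w" using vs.lin_exists[OF cd] by blast
  have "w \<boxplus> x = x" using vs.lin_unique[OF f(1) vs_sum[OF w g(2) d] f(2)] .
  then have "w = zeroV"
    using M.add.r_cancel_one[of x w] vs.lin_closed[OF w] vs.lin_closed[OF f(2)] by simp
  then have "d \<cdot> b = \<^bold>0" using basis w cd b unfolding basis_def by simp
  then show "f \<cdot> b = g \<cdot> b" using d b g unfolding is_sum_iff by simp
qed

lemma coordinates_exist: "x \<^bold>\<in> V \<Longrightarrow> \<exists>f. coeffs f \<and> vs.lin f x"
  using basis unfolding basis_def by blast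

definition colour :: "'m \<Rightarrow> 'm \<Rightarrow> bool" where
  "colour x k \<longleftrightarrow> (\<exists>f s. vs.dlin f x \<and> nm.dlin f s \<and> code s k)"

lemma colour_iff:
  assumes f: "coeffs f" "vs.lin f x" "nm.lin f s" shows "colour x k \<longleftrightarrow> code s k"
  unfolding colour_def vs.dlin_iff nm.dlin_iff
  using f coordinates_unique[OF _ _ f(1,2)] nm.lin_unique[OF f(1) _ f(3)] by metis

lemma colour_unique: assumes x: "x \<^bold>\<in> V" shows "\<exists>!k. colour x k"
proof -
  obtain f where f: "coeffs f" "vs.lin f x" using coordinates_exist[OF x] by blast
  obtain s where s: "nm.lin f s" using nm.lin_exists[OF f(1) vs.lin_fin_supp[OF f(2)]] by blast
  obtain k where "code s k" using code_exists[OF nm_nonneg[OF f(1) s]] by blast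
  then show ?thesis unfolding colour_iff[OF f s] using code_functional by blast
qed

text \<open>
  The heart of the proof: equal colours mean equal sums of squares, and the parallelogram law
  leaves zero for the sum of the squares of the coordinates of \<open>x - y\<close>.
\<close>
lemma colour_separates:
  assumes x: "x \<^bold>\<in> V" and y: "y \<^bold>\<in> V"
    and k: "colour (x \<boxplus> x) k" "colour (x \<boxplus> y) k" "colour (y \<boxplus> y) k"
  shows "x = y"
proof -
  obtain f where f: "coeffs f" "vs.lin f x" using coordinates_exist[OF x] by blast
  obtain g where g: "coeffs g" "vs.lin g y" using coordinates_exist[OF y] by blast
  obtain u v m d where s: "is_sum u f f" "is_sum v g g" "is_sum m f g" "is_sum f d g"
    using sum_exists difference_exists f(1) g(1) by meson
  have co: "coeffs u" "coeffs v" "coeffs m" "coeffs d" using s unfolding is_sum_iff by auto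
  obtain su sv sm sd where l: "nm.lin u su" "nm.lin v sv" "nm.lin m sm" "nm.lin d sd"
    and eq: "su \<^bold>+ sv = (sm \<^bold>+ sd) \<^bold>+ (sm \<^bold>+ sd)"
    by (rule nm_parallelogram[OF f(1) vs.lin_fin_supp[OF f(2)] g(1) vs.lin_fin_supp[OF g(2)] s])
      (rule that)
  have S: "su \<^bold>\<in> Q" "sv \<^bold>\<in> Q" "sm \<^bold>\<in> Q" "sd \<^bold>\<in> Q" using nm.lin_closed l by auto
  have "code su k" "code sv k" "code sm k"
    using k colour_iff[OF co(1) vs_sum[OF f(2) f(2) s(1)] l(1)]
      colour_iff[OF co(2) vs_sum[OF g(2) g(2) s(2)] l(2)]
      colour_iff[OF co(3) vs_sum[OF f(2) g(2) s(3)] l(3)] by auto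
  then have "su = sm" "sv = sm" using code_inj by blast+
  then have "(sm \<^bold>+ sm) \<^bold>+ (sd \<^bold>+ sd) = sm \<^bold>+ sm"
    using eq S K.a_assoc K.a_lcomm by (simp add: K.a_ac)
  then have "sd \<^bold>+ sd = \<^bold>0" using K.add.l_cancel_one[of "sm \<^bold>+ sm" "sd \<^bold>+ sd"] S by simp
  then have "sd = \<^bold>0" using nonneg_add_eq_zero nm_nonneg[OF co(4) l(4)] by blast
  then have "d \<cdot> b = \<^bold>0" if "b \<^bold>\<in> B" for b using nm_definite[OF co(4) _ that] l(4) by simp
  then have "f \<cdot> b = g \<cdot> b" if "b \<^bold>\<in> B" for b using that s(4) unfolding is_sum_iff by simp
  then have "f = g" using func_ext[OF f(1) g(1)] by blast
  then show "x = y" using vs.lin_unique[OF f] g(2) by blast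
qed

lemma mem_sumset:
  assumes X: "is_subset mem X V"
  shows "w \<^bold>\<in> sumset mem vs.M X \<longleftrightarrow> (\<exists>x y. x \<^bold>\<in> X \<and> y \<^bold>\<in> X \<and> w = x \<boxplus> y)"
proof -
  have XV: "x \<^bold>\<in> V" if "x \<^bold>\<in> X" for x using X that unfolding is_subset_def by blast
  define S where "S w \<longleftrightarrow> (\<exists>x y. x \<^bold>\<in> X \<and> y \<^bold>\<in> X \<and> w = dplus x y)" for w
  have S: "S w \<longleftrightarrow> (\<exists>x y. x \<^bold>\<in> X \<and> y \<^bold>\<in> X \<and> w = x \<boxplus> y)" for w
    unfolding S_def using XV dplus by metis
  have "dfn (\<lambda>e. S (e 0))" unfolding S_def by (intro vs_dfn_intros)
  then obtain b where "\<forall>w. w \<^bold>\<in> b \<longleftrightarrow> w \<^bold>\<in> V \<and> S w" using separation_dfn by blast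
  moreover have "w \<^bold>\<in> V" if "S w" for w using that XV vs.ad_closed unfolding S by blast
  ultimately have "\<exists>b. \<forall>w. w \<^bold>\<in> b \<longleftrightarrow> (\<exists>x y. x \<^bold>\<in> X \<and> y \<^bold>\<in> X \<and> w = x \<boxplus> y)"
    unfolding S by blast
  then show ?thesis unfolding sumset_def vs.M_simps(4) by (rule ex_uniq_set)
qed

theorem good_colouring:
  "\<exists>c. c : V \<leadsto> \<omega> \<and> \<not> (\<exists>X. is_subset mem X V \<and> two_elements mem X \<and>
      monochromatic mem c (sumset mem vs.M X))"
proof -
  obtain c where c: "c : V \<leadsto> \<omega>" and cx: "\<And>x. x \<^bold>\<in> V \<Longrightarrow> c \<cdot> x = (THE k. colour x k)"
  proof (rule func_exists[of colour V "\<lambda>x. THE k. colour x k" \<omega>])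
    show "dfn (\<lambda>e. colour (e 0) (e 1))" unfolding colour_def by (intro vs_dfn_intros)
  next
    fix x assume "x \<^bold>\<in> V"
    then have *: "colour x (THE k. colour x k)" using theI'[OF colour_unique] by blast
    then show "(THE k. colour x k) \<^bold>\<in> \<omega>" unfolding colour_def code_def by blast
  next
    fix x y assume "x \<^bold>\<in> V"
    then show "colour x y \<longleftrightarrow> y = (THE k. colour x k)"
      using theI'[OF colour_unique] the1_equality[OF colour_unique] by metis
  qed (rule that)
  have col: "colour x (c \<cdot> x)" if "x \<^bold>\<in> V" for x
    using theI'[OF colour_unique[OF that]] cx[OF that] by simp
  have False if X: "is_subset mem X V" and two: "two_elements mem X"
    and mono: "monochromatic mem c (sumset mem vs.M X)" for X
  proof -
    obtain x y where xy: "x \<noteq> y" "X = upair mem x y" using two unfolding two_elements_def by blast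
    have mem: "x \<^bold>\<in> X" "y \<^bold>\<in> X" using xy mem_upair by auto
    then have V: "x \<^bold>\<in> V" "y \<^bold>\<in> V" using X unfolding is_subset_def by auto
    have "a \<boxplus> b \<^bold>\<in> sumset mem vs.M X" if "a \<^bold>\<in> X" "b \<^bold>\<in> X" for a b
      using mem_sumset[OF X] that by blast
    then have "c \<cdot> (x \<boxplus> y) = c \<cdot> (x \<boxplus> x)" "c \<cdot> (y \<boxplus> y) = c \<cdot> (x \<boxplus> x)"
      using mono mem unfolding monochromatic_def by blast+
    then have "colour (x \<boxplus> x) (c \<cdot> (x \<boxplus> x))" "colour (x \<boxplus> y) (c \<cdot> (x \<boxplus> x))"
      "colour (y \<boxplus> y) (c \<cdot> (x \<boxplus> x))"
      using col[of "x \<boxplus> x"] col[of "x \<boxplus> y"] col[of "y \<boxplus> y"] V vs.ad_closed by auto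
    then show False using colour_separates[OF V] xy(1) by blast
  qed
  then show ?thesis using c by blast
qed

end

theorem theorem3p5:
  fixes mem :: "'m \<Rightarrow> 'm \<Rightarrow> bool"
    and Q plusQ timesQ zeroQ oneQ :: 'm
    and V plusV scaleV zeroV :: 'm
  assumes ZF: "ZF_model mem"
    and rationals: "rationals mem Q plusQ timesQ zeroQ oneQ"
    and vector_space:
      "vector_space_over mem Q (ring_of mem Q plusQ timesQ zeroQ oneQ) V plusV scaleV zeroV"
    and has_basis:
      "\<exists>B. basis mem Q (ring_of mem Q plusQ timesQ zeroQ oneQ)
                 V (module_of mem V plusV scaleV zeroV) B"
  shows "\<exists>c. func mem c V (omega mem) \<and>
           \<not> (\<exists>X. is_subset mem X V \<and> two_elements mem X \<and>
                  monochromatic mem c (sumset mem (module_of mem V plusV scaleV zeroV) X))"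
proof -
  have ring: "\<zero>\<^bsub>ring_of mem Q plusQ timesQ zeroQ oneQ\<^esub> = zeroQ"
    "\<one>\<^bsub>ring_of mem Q plusQ timesQ zeroQ oneQ\<^esub> = oneQ"
    "x \<oplus>\<^bsub>ring_of mem Q plusQ timesQ zeroQ oneQ\<^esub> y = app mem plusQ (pair mem x y)"
    "x \<otimes>\<^bsub>ring_of mem Q plusQ timesQ zeroQ oneQ\<^esub> y = app mem timesQ (pair mem x y)" for x y
    by (simp_all add: ring_of_def)
  obtain i where "rational_field mem Q plusQ timesQ zeroQ oneQ i"
    using rationals ZF unfolding rationals_def Let_def ring
    by (auto simp: rational_field_def rational_field_axioms_def)
  then interpret F: rational_field mem Q plusQ timesQ zeroQ oneQ i .
  obtain B where B: "basis mem Q F.K V (module_of mem V plusV scaleV zeroV) B"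
    using has_basis unfolding F.K_def by blast
  obtain sq where sq: "func mem sq (cross mem Q V) Q"
    "\<And>q x. mem q Q \<Longrightarrow> mem x V \<Longrightarrow> app mem sq (pair mem q x) = q \<otimes>\<^bsub>F.K\<^esub> q"
    by (rule F.square_map_exists) (rule that)
  interpret S: rational_space mem Q plusQ timesQ zeroQ oneQ i V plusV scaleV zeroV B sq
    using vector_space B sq unfolding vector_space_over_def F.K_def[symmetric]
    by (intro rational_space.intro rational_space_axioms.intro F.rational_field_axioms) blast+
  show ?thesis by (rule S.good_colouring)
qed

end
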